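(* Let $N\ge2$, let $\boldsymbol{\mu}\in\mathbb{R}^N_+$ and let $\boldsymbol{\Sigma}\in\mathbb{S}^N$ be a symmetric matrix (not necessarily positive semidefinite) with nonnegative entries along the diagonal. Define $$\mathcal{Q}_{\mathrm{cm}}:=\Big\{\mathbb{P}\in\mathcal{P}(\mathbb{R}^N_+)\ \Big|\ \mathbb{E}_{\mathbb{P}}[\tilde{\boldsymbol{\xi}}]=\boldsymbol{\mu},\ \mathbb{E}_{\mathbb{P}}[\mathrm{diag}(\tilde{\boldsymbol{\xi}}\tilde{\boldsymbol{\xi}}')]=\mathrm{diag}(\boldsymbol{\mu}\boldsymbol{\mu}'+\boldsymbol{\Sigma}),\ \mathbb{E}_{\mathbb{P}}[(\tilde{\boldsymbol{\xi}}-\boldsymbol{\mu})(\tilde{\boldsymbol{\xi}}-\boldsymbol{\mu})']\ge\boldsymbol{\Sigma}\Big\},$$ where the last inequality is entrywise. Let $\boldsymbol{A}_1,\ldots,\boldsymbol{A}_K\in\mathbb{S}^N$, with $A_{i,j,k}$ the $(i,j)$ entry of $\boldsymbol{A}_k$, let $\boldsymbol{b}_1,\ldots,\boldsymbol{b}_K\in\mathbb{R}^N$, with $b_{i,k}$ the $i$th entry of $\boldsymbol{b}_k$, let $c_1,\ldots,c_K\in\mathbb{R}$, and let $$\rho^*:=\sup_{\mathbb{P}\in\mathcal{Q}_{\mathrm{cm}}}\mathbb{E}_{\mathbb{P}}\Big[\max_{k\in[K]}\big(\tilde{\boldsymbol{\xi}}'\boldsymbol{A}_k\tilde{\boldsymbol{\xi}}+\boldsymbol{b}_k'\tilde{\boldsymbol{\xi}}+c_k\big)\Big].$$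 Suppose the off-diagonal entries of the matrices $\boldsymbol{A}_k$ are nonnegative for each $k\in[K]$. Then $\rho^*$ is given by the optimal value of the polynomial sized semidefinite program in the real decision variables $\lambda_k$, $\lambda_{i,k}$, $\lambda_{i,i,k}$ ($i\in[N]$, $k\in[K]$) and $\lambda_{i,j,k}$ ($(i,j)\in[N]_2$, $k\in[K]$): $$\max_{\boldsymbol{\lambda}}\ \sum_{k\in[K]}\Big(\sum_{(i,j)\in[N]_2}2A_{i,j,k}\lambda_{i,j,k}+\sum_{i\in[N]}\big(A_{i,i,k}\lambda_{i,i,k}+b_{i,k}\lambda_{i,k}\big)+c_k\lambda_k\Big)$$ subject to $$\sum_{k\in[K]}\lambda_k=1,$$ $$\sum_{k\in[K]}\lambda_{i,k}=\mu_i,\quad\forall i\in[N],$$ $$\sum_{k\in[K]}\lambda_{i,i,k}=\mu_i^2+\Sigma_{i,i},\quad\forall i\in[N],$$ $$\sum_{k\in[K]}\lambda_{i,j,k}\ge\mu_i\mu_j+\Sigma_{i,j},\quad\forall(i,j)\in[N]_2,$$ $$\begin{pmatrix}\lambda_k&\lambda_{i,k}&\lambda_{j,k}\\ \lambda_{i,k}&\lambda_{i,i,k}&\lambda_{i,j,k}\\ \lambda_{j,k}&\lambda_{i,j,k}&\lambda_{j,j,k}\end{pmatrix}\succeq0,\quad\forall(i,j)\in[N]_2,\ \forall k\in[K],$$ $$\lambda_{i,k}\ge0,\quad\forall i\in[N],\ \forall k\in[K].$$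
   Context: $[N]=\{1,\ldots,N\}$ and $[N]_2=\{(i,j):1\le i<j\le N\}$. $\mathbb{S}^N$ is the set of real symmetric $N\times N$ matrices; a prime denotes transpose; $\mathrm{diag}(\boldsymbol{X})$ is the vector of diagonal entries of $\boldsymbol{X}$; $\boldsymbol{X}\succeq0$ means $\boldsymbol{X}$ is positive semidefinite. $\mathcal{P}(\mathbb{R}^N_+)$ is the set of all probability distributions with support contained in the nonnegative orthant $\mathbb{R}^N_+$; $\tilde{\boldsymbol{\xi}}$ is a random vector with distribution $\mathbb{P}$. Thus in $\mathcal{Q}_{\mathrm{cm}}$ the mean of $\tilde{\xi}_i$ is fixed to $\mu_i$, its variance is fixed to $\Sigma_{i,i}$, and $\mathrm{Cov}(\tilde{\xi}_i,\tilde{\xi}_j)\ge\Sigma_{i,j}$ for each pair. "Polynomial sized" means that the number of variables and constraints is polynomial in $N$ and $K$.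
   Formalization: The formal theorem additionally assumes that Σ_{i,i}=0 whenever μ_i=0; otherwise Q_cm is empty while the program can be feasible (e.g. N=2, K=1, μ=0, Σ=I, A=0, b=0, c=0), so the stated equality fails. *)

theory Defs
  imports "HOL-Probability.Probability"
begin

text \<open>
  The dimension is \<open>N = CARD('n)\<close>; a linear order on the index type gives meaning to
  \<open>i < j\<close>.  The number of pieces is \<open>K = CARD('k)\<close>.  The covariance matrix is written \<open>S\<close>.
\<close>

type_synonym 'n rvec = "real^'n"
type_synonym 'n rmat = "real^'n^'n"

definition symmetric_matrix :: "'m::finite rmat \<Rightarrow> bool" where
  "symmetric_matrix M \<longleftrightarrow> transpose M = M"

definition psd :: "'m::finite rmat \<Rightarrow> bool" where
  "psd M \<longleftrightarrow> symmetric_matrix M \<and> (\<forall>x. 0 \<le> x \<bullet> (M *v x))"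

definition orthant :: "('n::finite rvec) set" where
  "orthant = {x. \<forall>i. 0 \<le> x $ i}"

text \<open>
  The orthant is closed, so the support of \<open>P\<close> lies in it iff \<open>P\<close> gives it full mass.
\<close>
definition orthant_distributions :: "('n::finite rvec) measure set" where
  "orthant_distributions =
     {P. prob_space P \<and> sets P = sets borel \<and> (AE x in P. x \<in> orthant)}"

text \<open>
  Integrability of the moments is required explicitly, because the Bochner integral of a
  non-integrable function is \<open>0\<close>.
\<close>
definition Qcm :: "'n::finite rvec \<Rightarrow> 'n rmat \<Rightarrow> ('n rvec) measure set" where
  "Qcm \<mu> S = {P \<in> orthant_distributions.
     has_bochner_integral P (\<lambda>x. x) \<mu> \<and>
     (\<forall>i. has_bochner_integral P (\<lambda>x. x $ i * x $ i) (\<mu> $ i * \<mu> $ i + S $ i $ i)) \<and>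
     (\<forall>i j. integrable P (\<lambda>x. (x - \<mu>) $ i * (x - \<mu>) $ j) \<and>
            (\<integral>x. (x - \<mu>) $ i * (x - \<mu>) $ j \<partial>P) \<ge> S $ i $ j)}"

definition max_quadratic ::
    "('k::finite \<Rightarrow> 'n::finite rmat) \<Rightarrow> ('k \<Rightarrow> 'n rvec) \<Rightarrow> ('k \<Rightarrow> real) \<Rightarrow> 'n rvec \<Rightarrow> real" where
  "max_quadratic A b c x = (MAX k. x \<bullet> (A k *v x) + b k \<bullet> x + c k)"

text \<open>
  The supremum is taken in the extended reals, so that it is \<open>-\<infinity>\<close> when no distribution is
  admissible.
\<close>
definition rho_star ::
    "'n::finite rvec \<Rightarrow> 'n rmat \<Rightarrow> ('k::finite \<Rightarrow> 'n rmat) \<Rightarrow> ('k \<Rightarrow> 'n rvec) \<Rightarrow> ('k \<Rightarrow> real) \<Rightarrow> ereal" where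
  "rho_star \<mu> S A b c = (SUP P \<in> Qcm \<mu> S. ereal (\<integral>x. max_quadratic A b c x \<partial>P))"

definition index_pairs :: "('n::linorder \<times> 'n) set" where
  "index_pairs = {(i, j). i < j}"

text \<open>
  \<open>Lam0 k\<close>, \<open>Lam1 i k\<close>, \<open>Lam2 i j k\<close> name the decision variables \<open>\<lambda>\<^sub>k\<close>, \<open>\<lambda>\<^sub>i\<^sub>,\<^sub>k\<close>, \<open>\<lambda>\<^sub>i\<^sub>,\<^sub>j\<^sub>,\<^sub>k\<close>.
  Only the names in \<open>sdp_variables\<close> (those with \<open>i \<le> j\<close>) are variables of the program, and a
  decision vector is a function that is extensional on this set.
\<close>
datatype ('n, 'k) sdp_variable = Lam0 'k | Lam1 'n 'k | Lam2 'n 'n 'k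

definition sdp_variables :: "('n::linorder, 'k) sdp_variable set" where
  "sdp_variables = {Lam0 k |k. True} \<union> {Lam1 i k |i k. True} \<union> {Lam2 i i k |i k. True}
     \<union> {Lam2 i j k |i j k. (i, j) \<in> index_pairs}"

datatype ('n, 'k) sdp_constraint =
    Total_mass | Mean 'n | Second_moment 'n | Cross_moment 'n 'n | Lmi 'n 'n 'k | Nonneg 'n 'k

definition sdp_constraints :: "('n::linorder, 'k) sdp_constraint set" where
  "sdp_constraints = {Total_mass} \<union> {Mean i |i. True} \<union> {Second_moment i |i. True}
     \<union> {Cross_moment i j |i j. (i, j) \<in> index_pairs}
     \<union> {Lmi i j k |i j k. (i, j) \<in> index_pairs} \<union> {Nonneg i k |i k. True}"

primrec satisfies ::
    "'n::finite rvec \<Rightarrow> 'n rmat \<Rightarrow> (('n, 'k::finite) sdp_variable \<Rightarrow> real) \<Rightarrow> ('n, 'k) sdp_constraint \<Rightarrow> bool"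
where
  "satisfies \<mu> S v Total_mass \<longleftrightarrow> (\<Sum>k\<in>UNIV. v (Lam0 k)) = 1"
| "satisfies \<mu> S v (Mean i) \<longleftrightarrow> (\<Sum>k\<in>UNIV. v (Lam1 i k)) = \<mu> $ i"
| "satisfies \<mu> S v (Second_moment i) \<longleftrightarrow> (\<Sum>k\<in>UNIV. v (Lam2 i i k)) = (\<mu> $ i)\<^sup>2 + S $ i $ i"
| "satisfies \<mu> S v (Cross_moment i j) \<longleftrightarrow>
     (\<Sum>k\<in>UNIV. v (Lam2 i j k)) \<ge> \<mu> $ i * \<mu> $ j + S $ i $ j"
| "satisfies \<mu> S v (Lmi i j k) \<longleftrightarrow> psd (vector
     [vector [v (Lam0 k),   v (Lam1 i k),   v (Lam1 j k)],
      vector [v (Lam1 i k), v (Lam2 i i k), v (Lam2 i j k)],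
      vector [v (Lam1 j k), v (Lam2 i j k), v (Lam2 j j k)]] :: real^3^3)"
| "satisfies \<mu> S v (Nonneg i k) \<longleftrightarrow> v (Lam1 i k) \<ge> 0"

definition sdp_feasible ::
    "'n::{finite,linorder} rvec \<Rightarrow> 'n rmat \<Rightarrow> (('n, 'k::finite) sdp_variable \<Rightarrow> real) set" where
  "sdp_feasible \<mu> S =
     {v \<in> extensional sdp_variables. \<forall>con \<in> sdp_constraints. satisfies \<mu> S v con}"

definition sdp_objective ::
    "('k::finite \<Rightarrow> 'n::{finite,linorder} rmat) \<Rightarrow> ('k \<Rightarrow> 'n rvec) \<Rightarrow> ('k \<Rightarrow> real) \<Rightarrow>
     (('n, 'k) sdp_variable \<Rightarrow> real) \<Rightarrow> real" where
  "sdp_objective A b c v =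
     (\<Sum>k\<in>UNIV. (\<Sum>(i, j)\<in>index_pairs. 2 * A k $ i $ j * v (Lam2 i j k))
        + (\<Sum>i\<in>UNIV. A k $ i $ i * v (Lam2 i i k) + b k $ i * v (Lam1 i k))
        + c k * v (Lam0 k))"

definition sdp_value ::
    "'n::{finite,linorder} rvec \<Rightarrow> 'n rmat \<Rightarrow> ('k::finite \<Rightarrow> 'n rmat) \<Rightarrow> ('k \<Rightarrow> 'n rvec) \<Rightarrow>
     ('k \<Rightarrow> real) \<Rightarrow> ereal" where
  "sdp_value \<mu> S A b c = (SUP v \<in> sdp_feasible \<mu> S. ereal (sdp_objective A b c v))"

text \<open>
  A nonnegative variable of mean \<open>0\<close> vanishes almost surely, so a coordinate with
  \<open>\<mu>\<^sub>i = 0 < S\<^sub>i\<^sub>i\<close> makes \<open>Qcm\<close> empty.  The semidefinite program can be feasible nevertheless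
  (take \<open>\<mu> = 0\<close>, \<open>S\<close> the identity and all \<open>Lam1\<close> equal to \<open>0\<close>), so that its value is not the supremum.
  This case has to be excluded by a hypothesis, which the following lemma shows to be implied by
  \<open>Qcm \<mu> S \<noteq> {}\<close>.
\<close>
lemma zero_variance_if_zero_mean:
  fixes \<mu> :: "real^'n"
  assumes "Qcm \<mu> S \<noteq> {}" "\<mu> $ i = 0"
  shows "S $ i $ i = 0"
proof -
  obtain P where P: "P \<in> Qcm \<mu> S" using assms by auto
  have nn: "AE x in P. 0 \<le> x $ i"
    using P by (auto simp: Qcm_def orthant_distributions_def orthant_def elim!: eventually_mono)
  have "has_bochner_integral P (\<lambda>x. x) \<mu>" using P by (simp add: Qcm_def)
  then have m: "has_bochner_integral P (\<lambda>x. x $ i) 0"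
    using has_bochner_integral_bounded_linear[OF bounded_linear_vec_nth[of i]] assms(2) by fastforce
  have "AE x in P. x $ i = 0"
    using integral_nonneg_eq_0_iff_AE[OF _ nn] m by (simp add: has_bochner_integral_iff)
  then have "(\<integral>x. x $ i * x $ i \<partial>P) = 0"
    by (intro integral_eq_zero_AE) (auto elim!: eventually_mono)
  then show ?thesis
    using P assms(2) by (auto simp: Qcm_def has_bochner_integral_iff)
qed

end

theory Submission
  imports Defs
begin

text \<open>
  A decision vector is a list, over the pieces \<open>k\<close>, of candidate moments \<open>1, x\<^sub>i, x\<^sub>i x\<^sub>j\<close> of the
  part of a distribution on which piece \<open>k\<close> attains the maximum.  The theorem says that the
  evident necessary conditions on such lists, imposed on three-by-three moment matrices only, are
  sufficient up to a limit.

  An admissible distribution yields a feasible point with the same objective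
  (\<open>distribution_yields_feasible\<close>): cut the space into Borel sets on which a fixed piece is maximal and
  take the moments of each part.  The moment matrices are positive semidefinite because
  \<open>(x + y \<xi>\<^sub>i + z \<xi>\<^sub>j)\<^sup>2\<close> has a nonnegative integral over each part.

  Conversely, let a feasible point have positive masses, and let vanishing first moments come with
  vanishing second moments.  Normalised by its mass, piece \<open>k\<close> prescribes means
  \<open>m\<^sub>i\<close> and standard deviations \<open>g\<^sub>i\<close>, and the three-by-three matrices bound the prescribed
  cross moments by \<open>m\<^sub>i m\<^sub>j + g\<^sub>i g\<^sub>j\<close> (\<open>moment_psd_correlation_bound\<close>).  All these bounds are attained
  simultaneously by the perfectly correlated vector \<open>m\<^sub>i + g\<^sub>i Z\<close>, where \<open>Z\<close> has mean 0 and variance 1.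
  A two-point variable \<open>Z\<close> with values \<open>1 / d\<close> and \<open>- d\<close> keeps the vector in the orthant when \<open>d\<close> is
  small (\<open>comonotone_mixture\<close>).  Cross moments may grow without harm: the constraints on
  them are lower bounds, and their objective coefficients are nonnegative.  The mixture of these
  vectors is an admissible distribution whose expected maximum is at least the objective value
  (\<open>interior_feasible_dominated\<close>).

  A general feasible point may have pieces of zero mass with positive second moments, to which no
  distribution corresponds.  It is a limit of points of the previous kind, obtained by moving
  along the segment towards \<open>uniform_point\<close>, which shares the moments equally among the
  pieces (\<open>sdp_objective_le_rho_star\<close>).  This is why the supremum over distributions need not be
  attained.  The program attains its maximum whenever it is feasible, since its feasible set is
  compact (\<open>compact_sdp_feasible\<close>).
\<close>

section \<open>Positive semidefinite moment matrices of a pair\<close>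

text \<open>
  The form of the symmetric matrix with rows \<open>(p, a, b)\<close>, \<open>(a, q, r)\<close>, \<open>(b, r, s)\<close>.  With \<open>p\<close> a mass,
  \<open>a, b\<close> first moments and \<open>q, r, s\<close> second moments, its value is the integral of
  \<open>(x + y \<xi>\<^sub>i + z \<xi>\<^sub>j)\<^sup>2\<close>.
\<close>
definition moment_psd :: "real \<Rightarrow> real \<Rightarrow> real \<Rightarrow> real \<Rightarrow> real \<Rightarrow> real \<Rightarrow> bool" where
  "moment_psd p a b q r s \<longleftrightarrow>
     (\<forall>x y z. 0 \<le> p * x\<^sup>2 + q * y\<^sup>2 + s * z\<^sup>2 + 2 * a * x * y + 2 * b * x * z + 2 * r * y * z)"

lemma psd_vector_iff_moment_psd:
  "psd (vector [vector [p, a, b], vector [a, q, r], vector [b, r, s]] :: real^3^3)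
     \<longleftrightarrow> moment_psd p a b q r s" (is "psd ?M \<longleftrightarrow> _")
proof -
  have form: "x \<bullet> (?M *v x) = p * (x$1)\<^sup>2 + q * (x$2)\<^sup>2 + s * (x$3)\<^sup>2
      + 2 * a * x$1 * x$2 + 2 * b * x$1 * x$3 + 2 * r * x$2 * x$3" for x :: "real^3"
    by (simp add: inner_vec_def matrix_vector_mult_def sum_3 vector_3 power2_eq_square algebra_simps)
  have "transpose ?M = ?M"
    by (simp add: transpose_def vec_eq_iff forall_3 vector_3)
  moreover have "(\<forall>x. 0 \<le> x \<bullet> (?M *v x)) \<longleftrightarrow> moment_psd p a b q r s"
  proof
    assume *: "\<forall>x. 0 \<le> x \<bullet> (?M *v x)"
    show "moment_psd p a b q r s"
      unfolding moment_psd_def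
    proof (intro allI)
      fix x y z :: real
      show "0 \<le> p * x\<^sup>2 + q * y\<^sup>2 + s * z\<^sup>2 + 2 * a * x * y + 2 * b * x * z + 2 * r * y * z"
        using *[rule_format, of "vector [x, y, z]"] unfolding form by (simp add: vector_3)
    qed
  next
    assume "moment_psd p a b q r s"
    then show "\<forall>x. 0 \<le> x \<bullet> (?M *v x)"
      unfolding form moment_psd_def by blast
  qed
  ultimately show ?thesis by (simp add: psd_def symmetric_matrix_def)
qed

lemma moment_psd_swap: "moment_psd p a b q r s \<Longrightarrow> moment_psd p b a s r q"
  unfolding moment_psd_def
proof (intro allI)
  fix x y z
  assume *: "\<forall>x y z. 0 \<le> p * x\<^sup>2 + q * y\<^sup>2 + s * z\<^sup>2 + 2 * a * x * y + 2 * b * x * z + 2 * r * y * z"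
  show "0 \<le> p * x\<^sup>2 + s * y\<^sup>2 + q * z\<^sup>2 + 2 * b * x * y + 2 * a * x * z + 2 * r * y * z"
    using *[rule_format, of x z y] by (simp add: algebra_simps)
qed

lemma moment_psd_add:
  assumes "moment_psd p a b q r s" "moment_psd p' a' b' q' r' s'"
  shows "moment_psd (p + p') (a + a') (b + b') (q + q') (r + r') (s + s')"
  unfolding moment_psd_def
proof (intro allI)
  fix x y z :: real
  show "0 \<le> (p + p') * x\<^sup>2 + (q + q') * y\<^sup>2 + (s + s') * z\<^sup>2 + 2 * (a + a') * x * y
      + 2 * (b + b') * x * z + 2 * (r + r') * y * z"
    using assms[unfolded moment_psd_def, THEN spec, THEN spec, THEN spec, of x y z]
    by (simp add: algebra_simps)
qed

lemma moment_psd_scale: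
  assumes "moment_psd p a b q r s" "0 \<le> t"
  shows "moment_psd (t * p) (t * a) (t * b) (t * q) (t * r) (t * s)"
  unfolding moment_psd_def
proof (intro allI)
  fix x y z :: real
  show "0 \<le> t * p * x\<^sup>2 + t * q * y\<^sup>2 + t * s * z\<^sup>2 + 2 * (t * a) * x * y
      + 2 * (t * b) * x * z + 2 * (t * r) * y * z"
    using mult_nonneg_nonneg[OF \<open>0 \<le> t\<close> assms(1)[unfolded moment_psd_def, THEN spec, THEN spec, THEN spec, of x y z]]
    by (simp add: algebra_simps)
qed

lemma moment_psd_sum:
  assumes "finite K" "\<And>k. k \<in> K \<Longrightarrow> moment_psd (p k) (a k) (b k) (q k) (r k) (s k)"
  shows "moment_psd (sum p K) (sum a K) (sum b K) (sum q K) (sum r K) (sum s K)"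
  using assms
proof (induction K rule: finite_induct)
  case empty
  then show ?case by (simp add: moment_psd_def)
next
  case (insert k K)
  then show ?case by (simp add: moment_psd_add)
qed

text \<open>
  Two perfectly correlated variables with means \<open>m, n\<close> and standard deviations \<open>g, h\<close> have these
  moments; the form is a sum of two squares.
\<close>
lemma moment_psd_of_covariance:
  "moment_psd 1 m n (m\<^sup>2 + g\<^sup>2) (m * n + g * h) (n\<^sup>2 + h\<^sup>2)"
  unfolding moment_psd_def
proof (intro allI)
  fix x y z :: real
  have "1 * x\<^sup>2 + (m\<^sup>2 + g\<^sup>2) * y\<^sup>2 + (n\<^sup>2 + h\<^sup>2) * z\<^sup>2 + 2 * m * x * y + 2 * n * x * z
      + 2 * (m * n + g * h) * y * z = (x + m * y + n * z)\<^sup>2 + (g * y + h * z)\<^sup>2"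
    by (simp add: power2_eq_square algebra_simps)
  then show "0 \<le> 1 * x\<^sup>2 + (m\<^sup>2 + g\<^sup>2) * y\<^sup>2 + (n\<^sup>2 + h\<^sup>2) * z\<^sup>2 + 2 * m * x * y + 2 * n * x * z
      + 2 * (m * n + g * h) * y * z" by simp
qed

lemma moment_psd_diagonal_nonneg:
  assumes "moment_psd p a b q r s"
  shows "0 \<le> p" "0 \<le> q"
  using assms[unfolded moment_psd_def, rule_format, of 1 0 0]
    assms[unfolded moment_psd_def, rule_format, of 0 1 0] by auto

lemma moment_psd_off_diagonal_bound:
  assumes "moment_psd p a b q r s"
  shows "2 * \<bar>r\<bar> \<le> q + s"
  using assms[unfolded moment_psd_def, rule_format, of 0 1 1]
    assms[unfolded moment_psd_def, rule_format, of 0 1 "-1"] by auto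

text \<open>
  Only the upper half of the determinant inequality \<open>\<gamma>\<^sup>2 \<le> \<alpha> \<beta>\<close> is kept, in the square-root form in
  which the product of two standard deviations will appear.
\<close>
lemma nonneg_binary_form_bound:
  fixes \<alpha> \<beta> \<gamma> :: real
  assumes form: "\<And>y z. 0 \<le> \<alpha> * y\<^sup>2 + \<beta> * z\<^sup>2 + 2 * \<gamma> * y * z"
  shows "\<gamma> \<le> sqrt \<alpha> * sqrt \<beta>"
proof (cases "\<gamma> \<le> 0")
  case True
  have "0 \<le> \<alpha>" "0 \<le> \<beta>" using form[of 1 0] form[of 0 1] by auto
  then have "0 \<le> sqrt \<alpha> * sqrt \<beta>" by simp
  with True show ?thesis by linarith
next
  case False
  then have "0 < \<gamma>" by simp
  have nn: "0 \<le> \<alpha>" "0 \<le> \<beta>" using form[of 1 0] form[of 0 1] by auto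
  \<comment> \<open>If a diagonal coefficient vanishes, these arguments give the form the value \<open>-1\<close>.\<close>
  have "\<alpha> \<noteq> 0"
    using form[of "(\<beta> + 1) / (2 * \<gamma>)" "-1"] \<open>0 < \<gamma>\<close> by auto
  moreover have "\<beta> \<noteq> 0"
    using form[of "-1" "(\<alpha> + 1) / (2 * \<gamma>)"] \<open>0 < \<gamma>\<close> by auto
  ultimately have pos: "0 < sqrt \<alpha> * sqrt \<beta>" using nn by simp
  have "0 \<le> 2 * (sqrt \<alpha> * sqrt \<beta>) * (sqrt \<alpha> * sqrt \<beta> - \<gamma>)"
  proof -
    define g h where "g = sqrt \<alpha>" and "h = sqrt \<beta>"
    then have "\<alpha> = g\<^sup>2" "\<beta> = h\<^sup>2" using nn by simp_all
    then show ?thesis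
      \<comment> \<open>The minimising direction of the form when the bound is an equality.\<close>
      using form[of h "- g"] unfolding g_def[symmetric] h_def[symmetric]
      by (simp add: power2_eq_square algebra_simps)
  qed
  with pos show ?thesis by (simp add: zero_le_mult_iff)
qed

text \<open>
  For \<open>p > 0\<close> the form is minimised over its first argument at \<open>x = - (a y + b z) / p\<close>, which leaves
  the form of the (unnormalised) covariance matrix.
\<close>
lemma moment_psd_schur_form:
  assumes "moment_psd p a b q r s" "0 < p"
  shows "0 \<le> (q - a\<^sup>2 / p) * y\<^sup>2 + (s - b\<^sup>2 / p) * z\<^sup>2 + 2 * (r - a * b / p) * y * z"
proof -
  define m n where "m = a / p" and "n = b / p"
  then have ab: "a = p * m" "b = p * n" using \<open>0 < p\<close> by simp_all
  have "0 \<le> p * (- (m * y + n * z))\<^sup>2 + q * y\<^sup>2 + s * z\<^sup>2 + 2 * a * (- (m * y + n * z)) * y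
      + 2 * b * (- (m * y + n * z)) * z + 2 * r * y * z"
    using assms(1) unfolding moment_psd_def by blast
  also have "\<dots> = (q - p * m\<^sup>2) * y\<^sup>2 + (s - p * n\<^sup>2) * z\<^sup>2 + 2 * (r - p * m * n) * y * z"
    unfolding ab by (simp add: algebra_simps power2_eq_square)
  finally show ?thesis
    using \<open>0 < p\<close> unfolding ab by (simp add: power2_eq_square algebra_simps)
qed

lemma moment_psd_variance_nonneg:
  assumes "moment_psd p a b q r s" "0 < p"
  shows "0 \<le> q - a\<^sup>2 / p"
  using moment_psd_schur_form[OF assms, of 1 0] by simp

text \<open>
  The Cauchy-Schwarz bound on a covariance, in unnormalised moments.  It is the only upper bound
  that the semidefinite constraints put on a cross moment.
\<close>
lemma moment_psd_correlation_bound: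
  assumes "moment_psd p a b q r s" "0 < p"
  shows "r \<le> a * b / p + sqrt (q - a\<^sup>2 / p) * sqrt (s - b\<^sup>2 / p)"
  using nonneg_binary_form_bound[OF moment_psd_schur_form[OF assms]] by linarith

section \<open>Quadratic pieces and the constraints in coordinates\<close>

lemma quadratic_form_symmetric:
  fixes M :: "'n::{finite,linorder} rmat"
  assumes "symmetric_matrix M"
  shows "x \<bullet> (M *v x) = (\<Sum>(i, j)\<in>index_pairs. 2 * M $ i $ j * (x $ i * x $ j))
    + (\<Sum>i\<in>UNIV. M $ i $ i * (x $ i * x $ i))"
proof -
  let ?f = "\<lambda>(i, j). M $ i $ j * (x $ i * x $ j)"
  let ?D = "range (\<lambda>i::'n. (i, i))"
  have sym: "M $ j $ i = M $ i $ j" for i j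
    using assms by (simp add: symmetric_matrix_def transpose_def vec_eq_iff)
  have "x \<bullet> (M *v x) = (\<Sum>i\<in>UNIV. \<Sum>j\<in>UNIV. M $ i $ j * (x $ i * x $ j))"
    by (simp add: inner_vec_def matrix_vector_mult_def sum_distrib_left ac_simps)
  also have "\<dots> = sum ?f UNIV"
    by (simp add: sum.cartesian_product)
  also have "\<dots> = sum ?f ((index_pairs \<union> prod.swap ` index_pairs) \<union> ?D)"
  proof (intro arg_cong[of _ _ "sum ?f"] set_eqI)
    fix e :: "'n \<times> 'n"
    show "e \<in> UNIV \<longleftrightarrow> e \<in> (index_pairs \<union> prod.swap ` index_pairs) \<union> ?D"
      by (cases "fst e" "snd e" rule: linorder_cases) (auto simp: index_pairs_def image_iff prod_eq_iff)
  qed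
  also have "\<dots> = sum ?f (index_pairs \<union> prod.swap ` index_pairs) + sum ?f ?D"
    by (rule sum.union_disjoint) (auto simp: index_pairs_def)
  also have "sum ?f (index_pairs \<union> prod.swap ` index_pairs)
      = sum ?f index_pairs + sum ?f (prod.swap ` index_pairs)"
    by (rule sum.union_disjoint) (auto simp: index_pairs_def)
  also have "sum ?f (prod.swap ` index_pairs) = sum ?f index_pairs"
    by (subst sum.reindex) (auto intro!: sum.cong simp: sym ac_simps)
  also have "sum ?f index_pairs + sum ?f index_pairs = (\<Sum>(i, j)\<in>index_pairs. 2 * M $ i $ j * (x $ i * x $ j))"
    by (simp add: sum.distrib[symmetric] split_def ac_simps)
  also have "sum ?f ?D = (\<Sum>i\<in>UNIV. M $ i $ i * (x $ i * x $ i))"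
    by (subst sum.reindex) (auto simp: inj_on_def)
  finally show ?thesis .
qed

lemma quadratic_piece_expand:
  fixes M :: "'n::{finite,linorder} rmat"
  assumes "symmetric_matrix M"
  shows "x \<bullet> (M *v x) + d \<bullet> x + e = (\<Sum>(i, j)\<in>index_pairs. 2 * M $ i $ j * (x $ i * x $ j))
    + (\<Sum>i\<in>UNIV. M $ i $ i * (x $ i * x $ i) + d $ i * x $ i) + e"
  unfolding quadratic_form_symmetric[OF assms] by (simp add: sum.distrib inner_vec_def)

text \<open>
  Decision vectors carry no information outside these names, so cross moments are always addressed
  with the smaller index first.
\<close>
lemma mem_sdp_variables [simp]:
  "Lam0 k \<in> sdp_variables" "Lam1 i k \<in> sdp_variables"
  "Lam2 i j k \<in> sdp_variables \<longleftrightarrow> i \<le> j"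
  by (auto simp: sdp_variables_def index_pairs_def)

lemma Ball_sdp_constraints:
  "(\<forall>con \<in> sdp_constraints. P con) \<longleftrightarrow> P Total_mass \<and> (\<forall>i. P (Mean i)) \<and> (\<forall>i. P (Second_moment i))
     \<and> (\<forall>i j. i < j \<longrightarrow> P (Cross_moment i j)) \<and> (\<forall>i j k. i < j \<longrightarrow> P (Lmi i j k))
     \<and> (\<forall>i k. P (Nonneg i k))"
  unfolding sdp_constraints_def index_pairs_def by blast

lemma sdp_feasible_iff:
  "v \<in> sdp_feasible \<mu> S \<longleftrightarrow> v \<in> extensional sdp_variables
     \<and> (\<Sum>k\<in>UNIV. v (Lam0 k)) = 1
     \<and> (\<forall>i. (\<Sum>k\<in>UNIV. v (Lam1 i k)) = \<mu> $ i)
     \<and> (\<forall>i. (\<Sum>k\<in>UNIV. v (Lam2 i i k)) = (\<mu> $ i)\<^sup>2 + S $ i $ i)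
     \<and> (\<forall>i j. i < j \<longrightarrow> \<mu> $ i * \<mu> $ j + S $ i $ j \<le> (\<Sum>k\<in>UNIV. v (Lam2 i j k)))
     \<and> (\<forall>i j k. i < j \<longrightarrow> moment_psd (v (Lam0 k)) (v (Lam1 i k)) (v (Lam1 j k))
          (v (Lam2 i i k)) (v (Lam2 i j k)) (v (Lam2 j j k)))
     \<and> (\<forall>i k. 0 \<le> v (Lam1 i k))"
  by (simp add: sdp_feasible_def Ball_sdp_constraints psd_vector_iff_moment_psd)

text \<open>
  The constraints are stated for \<open>i < j\<close> only; swapping the last two rows and columns of the matrix
  frees the order of the indices, so that any one index can be put in front.
\<close>
lemma sdp_feasible_lmi:
  assumes "v \<in> sdp_feasible \<mu> S" "i \<noteq> j"
  shows "moment_psd (v (Lam0 k)) (v (Lam1 i k)) (v (Lam1 j k))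
          (v (Lam2 i i k)) (v (Lam2 (min i j) (max i j) k)) (v (Lam2 j j k))"
  using assms by (cases i j rule: linorder_cases) (auto simp: sdp_feasible_iff intro: moment_psd_swap)

text \<open>
  Every single index has to lie in some pair: otherwise no matrix inequality would constrain its
  moments.
\<close>
lemma exists_other_index:
  fixes i :: "'n::finite"
  assumes "CARD('n) \<ge> 2"
  obtains j where "j \<noteq> i"
proof -
  have "UNIV \<noteq> {i}"
  proof
    assume "UNIV = {i}"
    then have "CARD('n) = card {i}" by (rule arg_cong)
    with assms show False by simp
  qed
  with that show ?thesis by auto
qed

text \<open>
  All first moments and diagonal entries are nonnegative with prescribed sums over the pieces, so
  each summand is bounded by its sum; the matrix inequality then bounds the cross moments.
\<close>
lemma sdp_feasible_bounded:
  assumes n2: "CARD('n) \<ge> 2"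
    and v: "(v :: ('n::{finite,linorder}, 'k::finite) sdp_variable \<Rightarrow> real) \<in> sdp_feasible \<mu> S"
  shows "0 \<le> v (Lam0 k)" "v (Lam0 k) \<le> 1" "0 \<le> v (Lam1 i k)" "v (Lam1 i k) \<le> \<mu> $ i"
    "0 \<le> v (Lam2 i i k)" "v (Lam2 i i k) \<le> (\<mu> $ i)\<^sup>2 + S $ i $ i"
    "i < j \<Longrightarrow> \<bar>v (Lam2 i j k)\<bar> \<le> ((\<mu> $ i)\<^sup>2 + S $ i $ i) + ((\<mu> $ j)\<^sup>2 + S $ j $ j)"
proof -
  note feas = v[unfolded sdp_feasible_iff]
  have nn: "0 \<le> v (Lam0 k) \<and> 0 \<le> v (Lam2 i i k)" for i k
  proof -
    obtain j where "j \<noteq> i" using exists_other_index[OF n2] by blast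
    then have "i \<noteq> j" by simp
    from moment_psd_diagonal_nonneg[OF sdp_feasible_lmi[OF v this]] show ?thesis by simp
  qed
  have nn1: "0 \<le> v (Lam1 i k)" for i k using feas by blast
  have le: "f k \<le> r" if "(\<Sum>k\<in>UNIV. f k) = r" "\<And>k. 0 \<le> f k" for f :: "'k \<Rightarrow> real" and r k
    using that member_le_sum[of k UNIV f] by auto
  show "0 \<le> v (Lam0 k)" "0 \<le> v (Lam1 i k)" "0 \<le> v (Lam2 i i k)" using nn nn1 by auto
  show "v (Lam0 k) \<le> 1" by (rule le[of "\<lambda>k. v (Lam0 k)"]) (use feas nn in auto)
  show "v (Lam1 i k) \<le> \<mu> $ i" by (rule le[of "\<lambda>k. v (Lam1 i k)"]) (use feas nn1 in auto)
  have second: "v (Lam2 i i k) \<le> (\<mu> $ i)\<^sup>2 + S $ i $ i" for i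
    by (rule le[of "\<lambda>k. v (Lam2 i i k)"]) (use feas nn in auto)
  then show "v (Lam2 i i k) \<le> (\<mu> $ i)\<^sup>2 + S $ i $ i" .
  assume "i < j"
  then have "2 * \<bar>v (Lam2 i j k)\<bar> \<le> v (Lam2 i i k) + v (Lam2 j j k)"
    using feas by (intro moment_psd_off_diagonal_bound) blast
  with second[of i] second[of j] nn[of k i] nn[of k j]
  show "\<bar>v (Lam2 i j k)\<bar> \<le> ((\<mu> $ i)\<^sup>2 + S $ i $ i) + ((\<mu> $ j)\<^sup>2 + S $ j $ j)" by linarith
qed

section \<open>From a distribution to a feasible point\<close>

text \<open>
  Ties are broken by an enumeration of the pieces: \<open>B k\<close> holds the points at which \<open>k\<close> is the first
  maximiser.
\<close>
lemma measurable_argmax_partition: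
  fixes q :: "'k::finite \<Rightarrow> 'a \<Rightarrow> real"
  assumes [measurable]: "\<And>k. q k \<in> borel_measurable M"
  obtains B :: "'k \<Rightarrow> 'a set" where "\<And>k. B k \<in> sets M" "\<And>x k k'. x \<in> B k \<Longrightarrow> q k' x \<le> q k x"
    "\<And>x. x \<in> space M \<Longrightarrow> \<exists>!k. x \<in> B k"
proof -
  obtain f :: "'k \<Rightarrow> nat" where f: "inj f"
    using finite_imp_inj_to_nat_seg[OF finite, of "UNIV :: 'k set"] by blast
  define B where
    "B k = {x \<in> space M. (\<forall>k'. q k' x \<le> q k x) \<and> (\<forall>k'. f k' < f k \<longrightarrow> q k' x < q k x)}" for k
  have "B k \<in> sets M" for k unfolding B_def by measurable
  moreover have "q k' x \<le> q k x" if "x \<in> B k" for x k k' using that by (simp add: B_def)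
  moreover have "\<exists>!k. x \<in> B k" if "x \<in> space M" for x
  proof -
    let ?best = "\<lambda>k. \<forall>k'. q k' x \<le> q k x"
    obtain k0 where k0: "q k0 x = Max (range (\<lambda>k. q k x))"
      using Max_in[of "range (\<lambda>k. q k x)"] by fastforce
    then have "?best k0" by simp
    then obtain k where k: "?best k" "\<And>k'. ?best k' \<Longrightarrow> f k \<le> f k'"
      using ex_has_least_nat[of ?best k0 f] by blast
    show ?thesis
    proof
      have "q k' x < q k x" if "f k' < f k" for k'
      proof (rule ccontr)
        assume "\<not> q k' x < q k x"
        then have "?best k'" using k(1) by (meson not_le order_trans)
        then have "f k \<le> f k'" by (rule k(2))
        with that show False by simp
      qed
      with k that show "x \<in> B k" by (simp add: B_def)
    next
      fix l assume l: "x \<in> B l"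
      have "q l x = q k x" using l k(1) by (auto simp: B_def intro: antisym)
      then have "?best l" using k(1) by simp
      then have "f k \<le> f l" by (rule k(2))
      moreover have "\<not> f k < f l" using l \<open>q l x = q k x\<close> by (auto simp: B_def)
      ultimately show "l = k" using f by (simp add: inj_eq)
    qed
  qed
  ultimately show ?thesis by (rule that)
qed

text \<open>
  The mixed second moments are recovered from the centred ones, for which \<open>Qcm\<close> states both
  integrability and the lower bound.
\<close>
lemma Qcm_moments:
  assumes P: "P \<in> Qcm \<mu> S"
  shows "prob_space P" "sets P = sets borel" "AE x in P. 0 \<le> x $ i"
    "integrable P (\<lambda>x. x $ i)" "(\<integral>x. x $ i \<partial>P) = \<mu> $ i"
    "integrable P (\<lambda>x. x $ i * x $ j)"
    "(\<integral>x. x $ i * x $ i \<partial>P) = (\<mu> $ i)\<^sup>2 + S $ i $ i"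
    "\<mu> $ i * \<mu> $ j + S $ i $ j \<le> (\<integral>x. x $ i * x $ j \<partial>P)"
proof -
  show "prob_space P" "sets P = sets borel"
    using P by (simp_all add: Qcm_def orthant_distributions_def)
  then interpret prob_space P by simp
  show "AE x in P. 0 \<le> x $ i"
    using P by (auto simp: Qcm_def orthant_distributions_def orthant_def elim: eventually_mono)
  have "has_bochner_integral P (\<lambda>x. x) \<mu>" using P by (simp add: Qcm_def)
  then have m: "has_bochner_integral P (\<lambda>x. x $ i) (\<mu> $ i)" for i
    by (rule has_bochner_integral_bounded_linear[OF bounded_linear_vec_nth])
  then have int: "integrable P (\<lambda>x. x $ i)" and mean: "(\<integral>x. x $ i \<partial>P) = \<mu> $ i" for i
    by (auto simp: has_bochner_integral_iff)
  show "integrable P (\<lambda>x. x $ i)" "(\<integral>x. x $ i \<partial>P) = \<mu> $ i" by (fact int mean)+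
  let ?d = "\<lambda>x. (x - \<mu>) $ i * (x - \<mu>) $ j"
  have d: "integrable P ?d" "S $ i $ j \<le> (\<integral>x. ?d x \<partial>P)" using P by (simp_all add: Qcm_def)
  have eq: "(\<lambda>x. x $ i * x $ j) = (\<lambda>x. ?d x + \<mu> $ i * x $ j + \<mu> $ j * x $ i - \<mu> $ i * \<mu> $ j)"
    by (simp add: fun_eq_iff algebra_simps)
  show "integrable P (\<lambda>x. x $ i * x $ j)"
    unfolding eq by (intro Bochner_Integration.integrable_add Bochner_Integration.integrable_diff
        integrable_mult_right d int integrable_const)
  have "(\<integral>x. x $ i * x $ j \<partial>P) = (\<integral>x. ?d x \<partial>P) + \<mu> $ i * \<mu> $ j"
    unfolding eq using d int by (simp add: mean prob_space)
  with d show "\<mu> $ i * \<mu> $ j + S $ i $ j \<le> (\<integral>x. x $ i * x $ j \<partial>P)" by simp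
  show "(\<integral>x. x $ i * x $ i \<partial>P) = (\<mu> $ i)\<^sup>2 + S $ i $ i"
    using P by (simp add: Qcm_def has_bochner_integral_iff power2_eq_square)
qed

lemma quadratic_piece_measurable:
  "(\<lambda>x. x \<bullet> (M *v x) + d \<bullet> x + e) \<in> borel_measurable (borel :: (real^'n) measure)"
  by (intro borel_measurable_continuous_onI continuous_intros linear_continuous_on matrix_vector_mul_bounded_linear)

text \<open>
  Piece \<open>k\<close> receives the moments of \<open>P\<close> restricted to the set \<open>B k\<close> on which it is maximal.  Summed
  over \<open>k\<close> they are the moments of \<open>P\<close>, and the expected maximum is the sum of the expectations of
  piece \<open>k\<close> over \<open>B k\<close>.
\<close>
lemma distribution_yields_feasible:
  fixes A :: "'k::finite \<Rightarrow> 'n::{finite,linorder} rmat"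
  assumes P: "P \<in> Qcm \<mu> S" and A: "\<And>k. symmetric_matrix (A k)"
  shows "\<exists>v \<in> sdp_feasible \<mu> S. sdp_objective A b c v = (\<integral>x. max_quadratic A b c x \<partial>P)"
proof -
  note mom = Qcm_moments[OF P]
  interpret prob_space P by (rule mom)
  define q where "q k x = x \<bullet> (A k *v x) + b k \<bullet> x + c k" for k x
  have "q k \<in> borel_measurable P" for k
    unfolding q_def[abs_def] measurable_cong_sets[OF mom(2) refl] by (rule quadratic_piece_measurable)
  then obtain B :: "'k \<Rightarrow> 'n rvec set" where B: "\<And>k. B k \<in> sets P"
      "\<And>x k k'. x \<in> B k \<Longrightarrow> q k' x \<le> q k x" "\<And>x. x \<in> space P \<Longrightarrow> \<exists>!k. x \<in> B k"
    by (rule measurable_argmax_partition[of q P]) blast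
  have "space P = UNIV" using sets_eq_imp_space_eq[OF mom(2)] by simp
  define J where "J k f = (\<integral>x. indicator (B k) x * f x \<partial>P)" for k and f :: "'n rvec \<Rightarrow> real"
  have J: "has_bochner_integral P (\<lambda>x. indicator (B k) x * f x) (J k f)" if "integrable P f" for k f
    using integrable_mult_indicator[OF B(1) that] by (simp add: J_def has_bochner_integral_iff)
  define sel where "sel x = (THE k. x \<in> B k)" for x
  have sel: "x \<in> B k \<longleftrightarrow> k = sel x" for x k
  proof -
    have ex: "\<exists>!k. x \<in> B k" using B(3) \<open>space P = UNIV\<close> by simp
    then have "x \<in> B (sel x)" unfolding sel_def by (rule theI')
    with ex show ?thesis by blast
  qed
  have ind_sum: "(\<Sum>k\<in>UNIV. indicator (B k) x * g k) = g (sel x)" for x and g :: "'k \<Rightarrow> real"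
  proof -
    have "indicator (B k) x * g k = (if k = sel x then g k else 0)" for k
      by (simp add: indicator_def sel)
    then show ?thesis by simp
  qed
  have J_sum: "(\<Sum>k\<in>UNIV. J k f) = (\<integral>x. f x \<partial>P)" if "integrable P f" for f
  proof -
    have "has_bochner_integral P (\<lambda>x. \<Sum>k\<in>UNIV. indicator (B k) x * f x) (\<Sum>k\<in>UNIV. J k f)"
      by (intro has_bochner_integral_sum J that)
    then show ?thesis
      unfolding ind_sum by (simp add: has_bochner_integral_iff)
  qed
  have one: "integrable P (\<lambda>x. 1)" by simp
  define w where "w u = (case u of Lam0 k \<Rightarrow> J k (\<lambda>x. 1) | Lam1 i k \<Rightarrow> J k (\<lambda>x. x $ i)
      | Lam2 i j k \<Rightarrow> J k (\<lambda>x. x $ i * x $ j))" for u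
  define v where "v = restrict w sdp_variables"
  have v_ext: "v \<in> extensional sdp_variables" by (simp add: v_def)
  have v [simp]: "v (Lam0 k) = J k (\<lambda>x. 1)" "v (Lam1 i k) = J k (\<lambda>x. x $ i)"
    "i \<le> j \<Longrightarrow> v (Lam2 i j k) = J k (\<lambda>x. x $ i * x $ j)" for i j k
    by (simp_all add: v_def w_def)
  have lmi: "moment_psd (J k (\<lambda>x. 1)) (J k (\<lambda>x. x $ i)) (J k (\<lambda>x. x $ j))
      (J k (\<lambda>x. x $ i * x $ i)) (J k (\<lambda>x. x $ i * x $ j)) (J k (\<lambda>x. x $ j * x $ j))" for i j k
    unfolding moment_psd_def
  proof (intro allI)
    fix X Y Z :: real
    let ?I = "indicator (B k) :: 'n rvec \<Rightarrow> real"
    have "has_bochner_integral P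
        (\<lambda>x. (?I x * 1) * X\<^sup>2 + (?I x * (x $ i * x $ i)) * Y\<^sup>2 + (?I x * (x $ j * x $ j)) * Z\<^sup>2
          + (?I x * x $ i) * (2 * X * Y) + (?I x * x $ j) * (2 * X * Z) + (?I x * (x $ i * x $ j)) * (2 * Y * Z))
        (J k (\<lambda>x. 1) * X\<^sup>2 + J k (\<lambda>x. x $ i * x $ i) * Y\<^sup>2 + J k (\<lambda>x. x $ j * x $ j) * Z\<^sup>2
          + J k (\<lambda>x. x $ i) * (2 * X * Y) + J k (\<lambda>x. x $ j) * (2 * X * Z)
          + J k (\<lambda>x. x $ i * x $ j) * (2 * Y * Z))"
      by (intro has_bochner_integral_add has_bochner_integral_mult_left J mom one)
    also have "(\<lambda>x. (?I x * 1) * X\<^sup>2 + (?I x * (x $ i * x $ i)) * Y\<^sup>2 + (?I x * (x $ j * x $ j)) * Z\<^sup>2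
          + (?I x * x $ i) * (2 * X * Y) + (?I x * x $ j) * (2 * X * Z) + (?I x * (x $ i * x $ j)) * (2 * Y * Z))
        = (\<lambda>x. ?I x * (X + Y * x $ i + Z * x $ j)\<^sup>2)"
      by (simp add: fun_eq_iff power2_eq_square algebra_simps)
    finally have "0 \<le> J k (\<lambda>x. 1) * X\<^sup>2 + J k (\<lambda>x. x $ i * x $ i) * Y\<^sup>2 + J k (\<lambda>x. x $ j * x $ j) * Z\<^sup>2
          + J k (\<lambda>x. x $ i) * (2 * X * Y) + J k (\<lambda>x. x $ j) * (2 * X * Z)
          + J k (\<lambda>x. x $ i * x $ j) * (2 * Y * Z)"
      using Bochner_Integration.integral_nonneg[of P "\<lambda>x. ?I x * (X + Y * x $ i + Z * x $ j)\<^sup>2"]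
      by (simp add: has_bochner_integral_iff)
    then show "0 \<le> J k (\<lambda>x. 1) * X\<^sup>2 + J k (\<lambda>x. x $ i * x $ i) * Y\<^sup>2 + J k (\<lambda>x. x $ j * x $ j) * Z\<^sup>2
        + 2 * J k (\<lambda>x. x $ i) * X * Y + 2 * J k (\<lambda>x. x $ j) * X * Z
        + 2 * J k (\<lambda>x. x $ i * x $ j) * Y * Z"
      by (simp add: mult_ac)
  qed
  have J_nonneg: "0 \<le> J k (\<lambda>x. x $ i)" for i k
    unfolding J_def by (intro integral_nonneg_AE eventually_mono[OF mom(3)[where i=i]]) simp
  have feasible: "v \<in> sdp_feasible \<mu> S"
    unfolding sdp_feasible_iff
  proof (intro conjI allI impI v_ext)
    show "(\<Sum>k\<in>UNIV. v (Lam0 k)) = 1" by (simp add: J_sum prob_space)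
    show "(\<Sum>k\<in>UNIV. v (Lam1 i k)) = \<mu> $ i" for i by (simp add: J_sum[OF mom(4)] mom(5))
    show "(\<Sum>k\<in>UNIV. v (Lam2 i i k)) = (\<mu> $ i)\<^sup>2 + S $ i $ i" for i
      by (simp add: J_sum[OF mom(6)] mom(7))
    show "\<mu> $ i * \<mu> $ j + S $ i $ j \<le> (\<Sum>k\<in>UNIV. v (Lam2 i j k))" if "i < j" for i j
      using that mom(8)[of i j] by (simp add: J_sum[OF mom(6)])
    show "moment_psd (v (Lam0 k)) (v (Lam1 i k)) (v (Lam1 j k))
        (v (Lam2 i i k)) (v (Lam2 i j k)) (v (Lam2 j j k))" if "i < j" for i j k
      using that lmi[of k i j] by simp
    show "0 \<le> v (Lam1 i k)" for i k by (simp add: J_nonneg)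
  qed
  have piece: "has_bochner_integral P (\<lambda>x. indicator (B k) x * q k x)
      ((\<Sum>(i, j)\<in>index_pairs. 2 * A k $ i $ j * v (Lam2 i j k))
        + (\<Sum>i\<in>UNIV. A k $ i $ i * v (Lam2 i i k) + b k $ i * v (Lam1 i k)) + c k * v (Lam0 k))" for k
  proof -
    let ?I = "indicator (B k) :: 'n rvec \<Rightarrow> real"
    have "has_bochner_integral P
       (\<lambda>x. (\<Sum>e\<in>index_pairs. 2 * A k $ fst e $ snd e * (?I x * (x $ fst e * x $ snd e)))
         + (\<Sum>i\<in>UNIV. A k $ i $ i * (?I x * (x $ i * x $ i)) + b k $ i * (?I x * x $ i))
         + c k * (?I x * 1))
       ((\<Sum>e\<in>index_pairs. 2 * A k $ fst e $ snd e * J k (\<lambda>x. x $ fst e * x $ snd e))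
        + (\<Sum>i\<in>UNIV. A k $ i $ i * J k (\<lambda>x. x $ i * x $ i) + b k $ i * J k (\<lambda>x. x $ i))
        + c k * J k (\<lambda>x. 1))"
      by (intro has_bochner_integral_add has_bochner_integral_sum has_bochner_integral_mult_right J mom one)
    also have "(\<lambda>x. (\<Sum>e\<in>index_pairs. 2 * A k $ fst e $ snd e * (?I x * (x $ fst e * x $ snd e)))
         + (\<Sum>i\<in>UNIV. A k $ i $ i * (?I x * (x $ i * x $ i)) + b k $ i * (?I x * x $ i))
         + c k * (?I x * 1)) = (\<lambda>x. ?I x * q k x)"
      unfolding q_def quadratic_piece_expand[OF A]
      by (simp add: fun_eq_iff split_def sum_distrib_left distrib_left ac_simps)
    also have "(\<Sum>e\<in>index_pairs. 2 * A k $ fst e $ snd e * J k (\<lambda>x. x $ fst e * x $ snd e))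
        = (\<Sum>(i, j)\<in>index_pairs. 2 * A k $ i $ j * v (Lam2 i j k))"
      by (auto intro!: sum.cong simp: index_pairs_def)
    finally show ?thesis by simp
  qed
  have "max_quadratic A b c x = (\<Sum>k\<in>UNIV. indicator (B k) x * q k x)" for x
  proof -
    have "x \<in> B (sel x)" by (simp add: sel)
    then show ?thesis
      unfolding ind_sum max_quadratic_def q_def[symmetric]
      by (intro Max_eqI) (auto intro: B(2))
  qed
  moreover have "has_bochner_integral P (\<lambda>x. \<Sum>k\<in>UNIV. indicator (B k) x * q k x) (sdp_objective A b c v)"
    unfolding sdp_objective_def by (intro has_bochner_integral_sum piece)
  ultimately have "(\<integral>x. max_quadratic A b c x \<partial>P) = sdp_objective A b c v"
    by (simp add: has_bochner_integral_iff)
  with feasible show ?thesis by auto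
qed

section \<open>From an interior feasible point to a distribution\<close>

text \<open>
  For weights \<open>w\<close> that are nonnegative with sum 1, the distribution with mass \<open>w a\<close> at \<open>X a\<close>;
  distinct indices may share a point.
\<close>
definition finite_law :: "('a::finite \<Rightarrow> real) \<Rightarrow> ('a \<Rightarrow> 'b) \<Rightarrow> 'b::topological_space measure" where
  "finite_law w X = distr (measure_pmf (embed_pmf w)) borel X"

lemma prob_space_finite_law: "prob_space (finite_law w X)"
  unfolding finite_law_def by (rule prob_space.prob_space_distr[OF prob_space_measure_pmf]) simp

lemma sets_finite_law [simp]: "sets (finite_law w X) = sets borel"
  by (simp add: finite_law_def)

lemma AE_finite_law:
  assumes "\<And>a. p (X a)" "{x. p x} \<in> sets borel"
  shows "AE x in finite_law w X. p x"
  unfolding finite_law_def using assms by (subst AE_distr_iff) auto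

lemma has_bochner_integral_finite_law:
  fixes f :: "'b::topological_space \<Rightarrow> 'c::{banach,second_countable_topology}"
  assumes w: "\<And>a. 0 \<le> w a" "(\<Sum>a\<in>UNIV. w a) = 1" and f: "f \<in> borel_measurable borel"
  shows "has_bochner_integral (finite_law w X) f (\<Sum>a\<in>UNIV. w a *\<^sub>R f (X a))"
proof -
  have "(\<integral>\<^sup>+ a. ennreal (w a) \<partial>count_space UNIV) = 1"
    using w by (simp add: nn_integral_count_space_finite sum_ennreal)
  then have pmf: "pmf (embed_pmf w) a = w a" for a
    using w by (simp add: pmf_embed_pmf)
  have "integrable (measure_pmf (embed_pmf w)) (\<lambda>a. f (X a))"
    by (rule integrable_measure_pmf_finite) simp
  moreover have "(\<integral>a. f (X a) \<partial>measure_pmf (embed_pmf w)) = (\<Sum>a\<in>UNIV. w a *\<^sub>R f (X a))"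
    by (subst integral_measure_pmf[of UNIV]) (simp_all add: pmf)
  ultimately show ?thesis
    unfolding finite_law_def
    by (intro has_bochner_integral_distr f) (auto simp: has_bochner_integral_iff)
qed

text \<open>
  A total mass \<open>p\<close> split between the values \<open>1 / d\<close> and \<open>- d\<close> so that the mean is 0 and the
  normalised second moment is 1.
\<close>
lemma two_point_law:
  fixes p d :: real
  assumes "0 < p" "0 < d"
  defines "u \<equiv> p * d\<^sup>2 / (1 + d\<^sup>2)" and "l \<equiv> p / (1 + d\<^sup>2)"
  shows "0 \<le> u" "0 \<le> l" "u + l = p" "u * (1 / d) + l * (- d) = 0"
    "u * (1 / d)\<^sup>2 + l * (- d)\<^sup>2 = p"
proof -
  have pos: "0 < 1 + d\<^sup>2" by (simp add: add_pos_nonneg)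
  show "0 \<le> u" "0 \<le> l" using assms by (simp_all add: u_def l_def)
  show "u + l = p"
    using pos unfolding u_def l_def add_divide_distrib[symmetric] 
    by (metis add.commute distrib_left mult.right_neutral nonzero_mult_div_cancel_right less_irrefl)
  have "u * (1 / d) = l * d" "u * (1 / d)\<^sup>2 = l" "l * (- d)\<^sup>2 = u"
    using \<open>0 < d\<close> by (simp_all add: u_def l_def power2_eq_square)
  then show "u * (1 / d) + l * (- d) = 0" "u * (1 / d)\<^sup>2 + l * (- d)\<^sup>2 = p"
    using \<open>u + l = p\<close> by simp_all
qed

text \<open>
  The downward deviation of \<open>m + g Z\<close> can be made arbitrarily small relative to \<open>g\<close>, so coordinates
  of positive mean stay nonnegative; a coordinate of mean 0 must not move at all.
\<close>
lemma downward_step_exists: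
  fixes m g :: "'n::finite \<Rightarrow> real"
  assumes "\<And>i. 0 \<le> m i" "\<And>i. 0 \<le> g i" "\<And>i. m i = 0 \<Longrightarrow> g i = 0"
  obtains d where "0 < d" "\<And>i. g i * d \<le> m i"
proof
  \<comment> \<open>The step \<open>1 / (1 + s)\<close> is at most every \<open>m i / g i\<close> with \<open>g i > 0\<close>, as \<open>s\<close> is at least every \<open>g i / m i\<close>.\<close>
  define s where "s = (\<Sum>i\<in>UNIV. g i / m i)"
  have nn: "0 \<le> g i / m i" for i using assms by simp
  then have "0 \<le> s" unfolding s_def by (simp add: sum_nonneg)
  then show "0 < 1 / (1 + s)" by simp
  show "g i * (1 / (1 + s)) \<le> m i" for i
  proof (cases "m i = 0")
    case False
    then have "0 < m i" using assms(1)[of i] by simp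
    have "g i / m i \<le> s" unfolding s_def by (rule member_le_sum) (use nn in auto)
    then have "g i \<le> m i * (1 + s)"
      using \<open>0 < m i\<close> by (simp add: field_simps)
    then show ?thesis using \<open>0 \<le> s\<close> by (simp add: field_simps)
  qed (simp add: assms)
qed

text \<open>
  For each \<open>k\<close>, all coordinates are driven by one two-point variable, so every pair is perfectly
  correlated and every cross moment is as large as the means \<open>m k\<close> and deviations \<open>g k\<close> permit.
\<close>
lemma comonotone_mixture:
  fixes p :: "'k::finite \<Rightarrow> real" and m g :: "'k \<Rightarrow> 'n::finite \<Rightarrow> real"
  assumes p: "\<And>k. 0 < p k" "(\<Sum>k\<in>UNIV. p k) = 1"
    and m: "\<And>k i. 0 \<le> m k i" and g: "\<And>k i. 0 \<le> g k i" "\<And>k i. m k i = 0 \<Longrightarrow> g k i = 0"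
  obtains w :: "'k \<times> bool \<Rightarrow> real" and X :: "'k \<times> bool \<Rightarrow> real^'n"
  where "\<And>a. 0 \<le> w a" "(\<Sum>a\<in>UNIV. w a) = 1" "\<And>a. X a \<in> orthant"
    "\<And>k. (\<Sum>h\<in>UNIV. w (k, h)) = p k"
    "\<And>k i. (\<Sum>h\<in>UNIV. w (k, h) * X (k, h) $ i) = p k * m k i"
    "\<And>k i j. (\<Sum>h\<in>UNIV. w (k, h) * (X (k, h) $ i * X (k, h) $ j))
        = p k * (m k i * m k j + g k i * g k j)"
proof -
  have "\<exists>d. 0 < d \<and> (\<forall>i. g k i * d \<le> m k i)" for k
    using downward_step_exists[of "m k" "g k"] m g by metis
  then obtain d where d: "\<And>k. 0 < d k" "\<And>k i. g k i * d k \<le> m k i" by metis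
  define w where "w = (\<lambda>(k, h). if h then p k * (d k)\<^sup>2 / (1 + (d k)\<^sup>2) else p k / (1 + (d k)\<^sup>2))"
  define z where "z k h = (if h then 1 / d k else - d k)" for k h
  define X :: "'k \<times> bool \<Rightarrow> real^'n" where "X = (\<lambda>(k, h). \<chi> i. m k i + g k i * z k h)"
  note law = two_point_law[OF p(1) d(1)]
  show ?thesis
  proof
    show "0 \<le> w a" for a using law(1,2) by (auto simp: w_def split: prod.splits)
    show mass: "(\<Sum>h\<in>UNIV. w (k, h)) = p k" for k
      using law(3)[of k k] by (simp add: w_def UNIV_bool)
    have "(\<Sum>a\<in>UNIV. w a) = (\<Sum>k\<in>UNIV. \<Sum>h\<in>UNIV. w (k, h))"
      by (simp add: sum.cartesian_product split_def)
    then show "(\<Sum>a\<in>UNIV. w a) = 1" by (simp add: mass p)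
    have "0 \<le> m k i + g k i * z k h" for k i h
      using m g d(1) d(2)[where k=k and i=i] by (auto simp: z_def less_imp_le)
    then show "X a \<in> orthant" for a by (auto simp: X_def orthant_def split: prod.splits)
    show "(\<Sum>h\<in>UNIV. w (k, h) * X (k, h) $ i) = p k * m k i" for k i
    proof -
      have "(\<Sum>h\<in>UNIV. w (k, h) * X (k, h) $ i) = (w (k, True) + w (k, False)) * m k i
          + (w (k, True) * z k True + w (k, False) * z k False) * g k i"
        by (simp add: X_def UNIV_bool algebra_simps)
      also have "\<dots> = p k * m k i"
        using law(3,4)[of k k] by (simp add: w_def z_def)
      finally show ?thesis .
    qed
    show "(\<Sum>h\<in>UNIV. w (k, h) * (X (k, h) $ i * X (k, h) $ j))
        = p k * (m k i * m k j + g k i * g k j)" for k i j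
    proof -
      have "(\<Sum>h\<in>UNIV. w (k, h) * (X (k, h) $ i * X (k, h) $ j))
        = (w (k, True) + w (k, False)) * (m k i * m k j)
          + (w (k, True) * z k True + w (k, False) * z k False) * (m k i * g k j + m k j * g k i)
          + (w (k, True) * (z k True)\<^sup>2 + w (k, False) * (z k False)\<^sup>2) * (g k i * g k j)"
        by (simp add: X_def UNIV_bool power2_eq_square algebra_simps)
      also have "\<dots> = p k * (m k i * m k j + g k i * g k j)"
        using law(3-5)[of k k] by (simp add: w_def z_def distrib_left)
      finally show ?thesis .
    qed
  qed
qed

lemma max_quadratic_measurable: "max_quadratic A b c \<in> borel_measurable borel"
proof -
  have "(\<lambda>x. Max ((\<lambda>k. x \<bullet> (A k *v x) + b k \<bullet> x + c k) ` UNIV)) \<in> borel_measurable borel"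
    by (rule borel_measurable_Max) (auto intro: quadratic_piece_measurable)
  then show ?thesis by (simp add: max_quadratic_def[abs_def])
qed

lemma sum_weighted_swap:
  fixes w :: "'h \<Rightarrow> real"
  shows "(\<Sum>h\<in>H. w h * (\<Sum>i\<in>I. r i * f i h)) = (\<Sum>i\<in>I. r i * (\<Sum>h\<in>H. w h * f i h))"
  unfolding sum_distrib_left by (subst sum.swap) (simp add: ac_simps)

text \<open>
  The comonotone mixture reproduces the masses, first moments and squares prescribed by \<open>v\<close> exactly
  and its cross moments can only be larger.  Hence its covariances still satisfy the lower bounds,
  each piece has at least the expectation which \<open>v\<close> ascribes to it, and evaluating the maximum instead
  of piece \<open>k\<close> on component \<open>k\<close> can only increase the value.
\<close>
lemma interior_feasible_dominated:
  fixes A :: "'k::finite \<Rightarrow> 'n::{finite,linorder} rmat"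
  assumes n2: "CARD('n) \<ge> 2" and S: "symmetric_matrix S"
    and A: "\<And>k. symmetric_matrix (A k)" and nonneg: "\<And>k i j. i \<noteq> j \<Longrightarrow> 0 \<le> A k $ i $ j"
    and v: "v \<in> sdp_feasible \<mu> S" and mass: "\<And>k. 0 < v (Lam0 k)"
    and degenerate: "\<And>i k. v (Lam1 i k) = 0 \<Longrightarrow> v (Lam2 i i k) = 0"
  shows "\<exists>P \<in> Qcm \<mu> S. sdp_objective A b c v \<le> (\<integral>x. max_quadratic A b c x \<partial>P)"
proof -
  note feas = v[unfolded sdp_feasible_iff]
  define p where "p k = v (Lam0 k)" for k
  define m where "m k i = v (Lam1 i k) / p k" for k i
  define y where "y k i = v (Lam2 i i k) - (v (Lam1 i k))\<^sup>2 / p k" for k i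
  define g where "g k i = sqrt (y k i / p k)" for k i
  have p: "0 < p k" for k using mass by (simp add: p_def)
  have y: "0 \<le> y k i" for k i
  proof -
    obtain j where "j \<noteq> i" using exists_other_index[OF n2] by blast
    then have "i \<noteq> j" by simp
    from moment_psd_variance_nonneg[OF sdp_feasible_lmi[OF v this] mass] show ?thesis
      by (simp add: y_def p_def)
  qed
  have pm: "p k * m k i = v (Lam1 i k)" for k i using p[of k] by (simp add: m_def)
  have gg: "p k * (g k i * g k j) = sqrt (y k i) * sqrt (y k j)" for k i j
    using p[of k] by (simp add: g_def real_sqrt_divide)
  have pmm: "p k * (m k i * m k j) = v (Lam1 i k) * v (Lam1 j k) / p k" for k i j
    using p[of k] by (simp add: m_def)
  have diag: "p k * (m k i * m k i + g k i * g k i) = v (Lam2 i i k)" for k i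
    using y[of k i] by (simp add: distrib_left gg pmm y_def power2_eq_square)
  have off: "v (Lam2 i j k) \<le> p k * (m k i * m k j + g k i * g k j)" if "i < j" for i j k
  proof -
    have "moment_psd (p k) (v (Lam1 i k)) (v (Lam1 j k))
        (v (Lam2 i i k)) (v (Lam2 i j k)) (v (Lam2 j j k))"
      using feas that by (simp add: p_def)
    from moment_psd_correlation_bound[OF this p] show ?thesis
      by (simp only: distrib_left gg pmm y_def)
  qed
  have m: "0 \<le> m k i" for k i using feas p[of k] by (simp add: m_def)
  have g0: "0 \<le> g k i" for k i using y p[of k] by (simp add: g_def)
  have g1: "g k i = 0" if "m k i = 0" for k i
    using degenerate[of i k] that p[of k] by (simp add: m_def g_def y_def)
  have sum_p: "(\<Sum>k\<in>UNIV. p k) = 1" using feas by (simp add: p_def)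
  obtain w :: "'k \<times> bool \<Rightarrow> real" and X :: "'k \<times> bool \<Rightarrow> 'n rvec"
  where w: "\<And>a. 0 \<le> w a" "(\<Sum>a\<in>UNIV. w a) = 1" and X: "\<And>a. X a \<in> orthant"
    and mix0: "\<And>k. (\<Sum>h\<in>UNIV. w (k, h)) = p k"
    and mix1: "\<And>k i. (\<Sum>h\<in>UNIV. w (k, h) * X (k, h) $ i) = p k * m k i"
    and mix2: "\<And>k i j. (\<Sum>h\<in>UNIV. w (k, h) * (X (k, h) $ i * X (k, h) $ j))
        = p k * (m k i * m k j + g k i * g k j)"
    by (rule comonotone_mixture[of p m g, OF p sum_p m g0]) (erule g1, rule that)
  define P where "P = finite_law w X"
  note int = has_bochner_integral_finite_law[OF w, of _ X, folded P_def]
  have split: "(\<Sum>a\<in>UNIV. f a) = (\<Sum>k\<in>UNIV. \<Sum>h\<in>UNIV. f (k, h))" for f :: "'k \<times> bool \<Rightarrow> real"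
    by (simp add: sum.cartesian_product split_def)
  have mean: "(\<Sum>a\<in>UNIV. w a * X a $ i) = \<mu> $ i" for i
    using feas by (simp add: split mix1 pm)
  have second: "(\<Sum>a\<in>UNIV. w a * (X a $ i * X a $ i)) = \<mu> $ i * \<mu> $ i + S $ i $ i" for i
    using feas by (simp add: split mix2 diag power2_eq_square)
  have cross_less: "\<mu> $ i * \<mu> $ j + S $ i $ j \<le> (\<Sum>a\<in>UNIV. w a * (X a $ i * X a $ j))"
    if "i < j" for i j
  proof -
    have "\<mu> $ i * \<mu> $ j + S $ i $ j \<le> (\<Sum>k\<in>UNIV. v (Lam2 i j k))" using feas that by blast
    also have "\<dots> \<le> (\<Sum>k\<in>UNIV. p k * (m k i * m k j + g k i * g k j))"
      by (intro sum_mono off that)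
    finally show ?thesis by (simp add: split mix2)
  qed
  have cross: "\<mu> $ i * \<mu> $ j + S $ i $ j \<le> (\<Sum>a\<in>UNIV. w a * (X a $ i * X a $ j))" for i j
  proof (cases i j rule: linorder_cases)
    case greater
    have "S $ i $ j = S $ j $ i" using S by (simp add: symmetric_matrix_def transpose_def vec_eq_iff)
    with cross_less[OF greater] show ?thesis by (simp add: mult.commute)
  qed (simp_all add: cross_less second)
  have "P \<in> Qcm \<mu> S"
    unfolding Qcm_def orthant_distributions_def
  proof (intro CollectI conjI allI)
    show "prob_space P" "sets P = sets borel"
      by (simp_all add: P_def prob_space_finite_law)
    have "closed {x :: 'n rvec. x \<in> orthant}"
      unfolding orthant_def mem_Collect_eq by (intro closed_Collect_all closed_Collect_le continuous_intros)
    then show "AE x in P. x \<in> orthant"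
      unfolding P_def by (intro AE_finite_law X borel_closed)
    have "(\<Sum>a\<in>UNIV. w a *\<^sub>R X a) = \<mu>" by (simp add: vec_eq_iff mean)
    with int[of "\<lambda>x. x"] show "has_bochner_integral P (\<lambda>x. x) \<mu>" by simp
    show "has_bochner_integral P (\<lambda>x. x $ i * x $ i) (\<mu> $ i * \<mu> $ i + S $ i $ i)" for i
      using int[of "\<lambda>x. x $ i * x $ i"] by (simp add: second)
    fix i j
    have cov: "has_bochner_integral P (\<lambda>x. (x - \<mu>) $ i * (x - \<mu>) $ j)
       (\<Sum>a\<in>UNIV. w a * ((X a - \<mu>) $ i * (X a - \<mu>) $ j))"
      using int[of "\<lambda>x. (x - \<mu>) $ i * (x - \<mu>) $ j"] by simp
    then show "integrable P (\<lambda>x. (x - \<mu>) $ i * (x - \<mu>) $ j)" by (auto simp: has_bochner_integral_iff)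
    have "(\<Sum>a\<in>UNIV. w a * ((X a - \<mu>) $ i * (X a - \<mu>) $ j))
      = (\<Sum>a\<in>UNIV. w a * (X a $ i * X a $ j)) - (\<Sum>a\<in>UNIV. w a * X a $ i) * \<mu> $ j
        - (\<Sum>a\<in>UNIV. w a * X a $ j) * \<mu> $ i + (\<Sum>a\<in>UNIV. w a) * (\<mu> $ i * \<mu> $ j)"
      unfolding sum_distrib_right sum_subtractf[symmetric] sum.distrib[symmetric]
      by (intro sum.cong) (simp_all add: algebra_simps)
    also have "\<dots> = (\<Sum>a\<in>UNIV. w a * (X a $ i * X a $ j)) - \<mu> $ i * \<mu> $ j"
      by (simp add: mean w)
    finally show "S $ i $ j \<le> (\<integral>x. (x - \<mu>) $ i * (x - \<mu>) $ j \<partial>P)"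
      using cov cross[of i j] by (simp add: has_bochner_integral_iff)
  qed
  moreover have "sdp_objective A b c v \<le> (\<integral>x. max_quadratic A b c x \<partial>P)"
  proof -
    let ?q = "\<lambda>k x. x \<bullet> (A k *v x) + b k \<bullet> x + c k"
    have piece: "(\<Sum>h\<in>UNIV. w (k, h) * ?q k (X (k, h)))
      = (\<Sum>(i, j)\<in>index_pairs. 2 * A k $ i $ j * (p k * (m k i * m k j + g k i * g k j)))
        + (\<Sum>i\<in>UNIV. A k $ i $ i * v (Lam2 i i k) + b k $ i * v (Lam1 i k)) + c k * v (Lam0 k)"
      for k
    proof -
      have "(\<Sum>h\<in>UNIV. w (k, h) * ?q k (X (k, h)))
        = (\<Sum>h\<in>UNIV. w (k, h) * (\<Sum>e\<in>index_pairs. 2 * A k $ fst e $ snd e * (X (k, h) $ fst e * X (k, h) $ snd e)))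
        + (\<Sum>h\<in>UNIV. w (k, h) * (\<Sum>i\<in>UNIV. A k $ i $ i * (X (k, h) $ i * X (k, h) $ i)))
        + (\<Sum>h\<in>UNIV. w (k, h) * (\<Sum>i\<in>UNIV. b k $ i * X (k, h) $ i))
        + (\<Sum>h\<in>UNIV. w (k, h)) * c k"
        unfolding quadratic_piece_expand[OF A]
        by (simp add: split_def distrib_left sum.distrib sum_distrib_right)
      also have "\<dots> = (\<Sum>e\<in>index_pairs. 2 * A k $ fst e $ snd e * (p k * (m k (fst e) * m k (snd e) + g k (fst e) * g k (snd e))))
        + (\<Sum>i\<in>UNIV. A k $ i $ i * v (Lam2 i i k)) + (\<Sum>i\<in>UNIV. b k $ i * v (Lam1 i k)) + v (Lam0 k) * c k"
        by (simp only: sum_weighted_swap[where f="\<lambda>e h. X (k, h) $ fst e * X (k, h) $ snd e"]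
            sum_weighted_swap[where f="\<lambda>i h. X (k, h) $ i * X (k, h) $ i"]
            sum_weighted_swap[where f="\<lambda>i h. X (k, h) $ i"] mix0 mix1 mix2 pm diag p_def[symmetric])
      finally show ?thesis by (simp add: split_def sum.distrib)
    qed
    have "sdp_objective A b c v \<le> (\<Sum>k\<in>UNIV. \<Sum>h\<in>UNIV. w (k, h) * ?q k (X (k, h)))"
      unfolding sdp_objective_def piece
    proof (intro sum_mono add_mono order_refl)
      fix k and e :: "'n \<times> 'n" assume "e \<in> index_pairs"
      then show "(case e of (i, j) \<Rightarrow> 2 * A k $ i $ j * v (Lam2 i j k))
        \<le> (case e of (i, j) \<Rightarrow> 2 * A k $ i $ j * (p k * (m k i * m k j + g k i * g k j)))"
        by (auto simp: index_pairs_def intro!: mult_left_mono off nonneg)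
    qed
    also have "\<dots> \<le> (\<Sum>k\<in>UNIV. \<Sum>h\<in>UNIV. w (k, h) * max_quadratic A b c (X (k, h)))"
      by (intro sum_mono mult_left_mono w) (auto simp: max_quadratic_def intro!: Max_ge)
    also have "\<dots> = (\<integral>x. max_quadratic A b c x \<partial>P)"
      using int[OF max_quadratic_measurable[of A b c]]
      by (simp add: has_bochner_integral_iff split)
    finally show ?thesis .
  qed
  ultimately show ?thesis by blast
qed

section \<open>Approximation by interior points\<close>

lemma moment_psd_uniform:
  "0 \<le> s \<Longrightarrow> 0 \<le> t \<Longrightarrow>
    moment_psd 1 m n (m * m + sqrt s * sqrt s) (m * n + sqrt s * sqrt t) (n * n + sqrt t * sqrt t)"
  using moment_psd_of_covariance[of m n "sqrt s" "sqrt t"] by (simp add: power2_eq_square)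

text \<open>
  Each piece carries the same share of a vector with means \<open>\<mu>\<close>, variances \<open>S\<^sub>i\<^sub>i\<close> and all
  correlations equal to 1.  The diagonal case \<open>i = j\<close> is covered by
  \<open>sqrt S\<^sub>i\<^sub>i * sqrt S\<^sub>i\<^sub>i = S\<^sub>i\<^sub>i\<close>.
\<close>
definition uniform_point :: "'n::{finite,linorder} rvec \<Rightarrow> 'n rmat \<Rightarrow> ('n, 'k::finite) sdp_variable \<Rightarrow> real" where
  "uniform_point \<mu> S = (\<lambda>u \<in> sdp_variables. 1 / CARD('k) * (case u of Lam0 k \<Rightarrow> 1 | Lam1 i k \<Rightarrow> \<mu> $ i
     | Lam2 i j k \<Rightarrow> \<mu> $ i * \<mu> $ j + sqrt (S $ i $ i) * sqrt (S $ j $ j)))"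

text \<open>
  The bounds \<open>S\<^sub>i\<^sub>j \<le> sqrt (S\<^sub>i\<^sub>i S\<^sub>j\<^sub>j)\<close>, without which perfect correlation would not suffice, are forced
  by the existence of some feasible point: add its matrices over all pieces.
\<close>
lemma uniform_point_feasible:
  fixes v :: "('n::{finite,linorder}, 'k::finite) sdp_variable \<Rightarrow> real"
  assumes v: "v \<in> sdp_feasible \<mu> S" and diag: "\<And>i. 0 \<le> S $ i $ i" and \<mu>: "\<mu> \<in> orthant"
  shows "(uniform_point \<mu> S :: ('n, 'k) sdp_variable \<Rightarrow> real) \<in> sdp_feasible \<mu> S"
proof -
  note feas = v[unfolded sdp_feasible_iff]
  have bound: "S $ i $ j \<le> sqrt (S $ i $ i) * sqrt (S $ j $ j)" if "i < j" for i j
  proof -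
    have "moment_psd (\<Sum>k\<in>UNIV. v (Lam0 k)) (\<Sum>k\<in>UNIV. v (Lam1 i k)) (\<Sum>k\<in>UNIV. v (Lam1 j k))
       (\<Sum>k\<in>UNIV. v (Lam2 i i k)) (\<Sum>k\<in>UNIV. v (Lam2 i j k)) (\<Sum>k\<in>UNIV. v (Lam2 j j k))"
      using feas that by (intro moment_psd_sum) auto
    then have "moment_psd 1 (\<mu> $ i) (\<mu> $ j) ((\<mu> $ i)\<^sup>2 + S $ i $ i) (\<Sum>k\<in>UNIV. v (Lam2 i j k))
        ((\<mu> $ j)\<^sup>2 + S $ j $ j)"
      using feas by simp
    from moment_psd_correlation_bound[OF this]
    have "(\<Sum>k\<in>UNIV. v (Lam2 i j k)) \<le> \<mu> $ i * \<mu> $ j + sqrt (S $ i $ i) * sqrt (S $ j $ j)" by simp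
    moreover have "\<mu> $ i * \<mu> $ j + S $ i $ j \<le> (\<Sum>k\<in>UNIV. v (Lam2 i j k))" using feas that by blast
    ultimately show ?thesis by simp
  qed
  let ?u = "uniform_point \<mu> S :: ('n, 'k) sdp_variable \<Rightarrow> real"
  have u: "?u (Lam0 k) = 1 / CARD('k) * 1" "?u (Lam1 i k) = 1 / CARD('k) * \<mu> $ i"
    "i \<le> j \<Longrightarrow> ?u (Lam2 i j k) = 1 / CARD('k) * (\<mu> $ i * \<mu> $ j + sqrt (S $ i $ i) * sqrt (S $ j $ j))" for i j k
    by (simp_all add: uniform_point_def)
  show ?thesis
    unfolding sdp_feasible_iff
  proof (intro conjI allI impI)
    show "?u \<in> extensional sdp_variables" by (simp add: uniform_point_def)
    show "(\<Sum>k\<in>UNIV. ?u (Lam0 k)) = 1" by (simp add: u)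
    show "(\<Sum>k\<in>UNIV. ?u (Lam1 i k)) = \<mu> $ i" for i by (simp add: u)
    show "(\<Sum>k\<in>UNIV. ?u (Lam2 i i k)) = (\<mu> $ i)\<^sup>2 + S $ i $ i" for i
      by (simp add: u diag power2_eq_square)
    show "\<mu> $ i * \<mu> $ j + S $ i $ j \<le> (\<Sum>k\<in>UNIV. ?u (Lam2 i j k))" if "i < j" for i j
      using bound[OF that] that by (simp add: u)
    show "moment_psd (?u (Lam0 k)) (?u (Lam1 i k)) (?u (Lam1 j k))
        (?u (Lam2 i i k)) (?u (Lam2 i j k)) (?u (Lam2 j j k))" if "i < j" for i j k
      unfolding u(1,2) u(3)[OF order_refl] u(3)[OF less_imp_le[OF that]]
      by (intro moment_psd_scale moment_psd_uniform diag) simp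
    show "0 \<le> ?u (Lam1 i k)" for i k using \<mu> by (simp add: u orthant_def)
  qed
qed

definition segment_point :: "real \<Rightarrow> (('n::linorder, 'k) sdp_variable \<Rightarrow> real)
    \<Rightarrow> (('n, 'k) sdp_variable \<Rightarrow> real) \<Rightarrow> ('n, 'k) sdp_variable \<Rightarrow> real" where
  "segment_point t v w = (\<lambda>u \<in> sdp_variables. (1 - t) * v u + t * w u)"

lemma segment_point_feasible:
  assumes "v \<in> sdp_feasible \<mu> S" "w \<in> sdp_feasible \<mu> S" and t: "0 \<le> t" "t \<le> 1"
  shows "segment_point t v w \<in> sdp_feasible \<mu> S"
proof -
  note v = assms(1)[unfolded sdp_feasible_iff] and w = assms(2)[unfolded sdp_feasible_iff]
  let ?u = "segment_point t v w"
  have u: "x \<in> sdp_variables \<Longrightarrow> ?u x = (1 - t) * v x + t * w x" for x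
    by (simp add: segment_point_def)
  have sum_u: "(\<Sum>k\<in>UNIV. ?u (f k)) = (1 - t) * (\<Sum>k\<in>UNIV. v (f k)) + t * (\<Sum>k\<in>UNIV. w (f k))"
    if "\<And>k. f k \<in> sdp_variables" for f
    using that by (simp add: u sum.distrib sum_distrib_left)
  show ?thesis
    unfolding sdp_feasible_iff
  proof (intro conjI allI impI)
    show "?u \<in> extensional sdp_variables" by (simp add: segment_point_def)
    show "(\<Sum>k\<in>UNIV. ?u (Lam0 k)) = 1" using v w by (simp add: sum_u)
    show "(\<Sum>k\<in>UNIV. ?u (Lam1 i k)) = \<mu> $ i" for i
      using v w by (simp add: sum_u algebra_simps)
    show "(\<Sum>k\<in>UNIV. ?u (Lam2 i i k)) = (\<mu> $ i)\<^sup>2 + S $ i $ i" for i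
      using v w by (simp add: sum_u algebra_simps)
    show "\<mu> $ i * \<mu> $ j + S $ i $ j \<le> (\<Sum>k\<in>UNIV. ?u (Lam2 i j k))" if "i < j" for i j
    proof -
      let ?c = "\<mu> $ i * \<mu> $ j + S $ i $ j"
      have "?c = (1 - t) * ?c + t * ?c" by (simp add: algebra_simps)
      also have "\<dots> \<le> (1 - t) * (\<Sum>k\<in>UNIV. v (Lam2 i j k)) + t * (\<Sum>k\<in>UNIV. w (Lam2 i j k))"
        using v w t that by (intro add_mono mult_left_mono) auto
      finally show ?thesis using that by (simp add: sum_u)
    qed
    show "moment_psd (?u (Lam0 k)) (?u (Lam1 i k)) (?u (Lam1 j k))
        (?u (Lam2 i i k)) (?u (Lam2 i j k)) (?u (Lam2 j j k))" if "i < j" for i j k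
    proof -
      have "moment_psd (v (Lam0 k)) (v (Lam1 i k)) (v (Lam1 j k))
          (v (Lam2 i i k)) (v (Lam2 i j k)) (v (Lam2 j j k))"
        "moment_psd (w (Lam0 k)) (w (Lam1 i k)) (w (Lam1 j k))
          (w (Lam2 i i k)) (w (Lam2 i j k)) (w (Lam2 j j k))"
        using v w that by blast+
      from moment_psd_add[OF moment_psd_scale[OF this(1)] moment_psd_scale[OF this(2)], of "1 - t" t]
      show ?thesis using t that by (simp add: u)
    qed
    show "0 \<le> ?u (Lam1 i k)" for i k using v w t by (simp add: u)
  qed
qed

lemma sdp_objective_segment_point:
  "sdp_objective A b c (segment_point t v w)
     = (1 - t) * sdp_objective A b c v + t * sdp_objective A b c w"
proof -
  define R where "R u k = (\<Sum>(i, j)\<in>index_pairs. 2 * A k $ i $ j * u (Lam2 i j k))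
    + (\<Sum>i\<in>UNIV. A k $ i $ i * u (Lam2 i i k) + b k $ i * u (Lam1 i k)) + c k * u (Lam0 k)" for u k
  have R: "R (segment_point t v w) k = (1 - t) * R v k + t * R w k" for k
  proof -
    have "(\<Sum>(i, j)\<in>index_pairs. 2 * A k $ i $ j * segment_point t v w (Lam2 i j k))
      = (1 - t) * (\<Sum>(i, j)\<in>index_pairs. 2 * A k $ i $ j * v (Lam2 i j k))
        + t * (\<Sum>(i, j)\<in>index_pairs. 2 * A k $ i $ j * w (Lam2 i j k))"
      unfolding sum_distrib_left sum.distrib[symmetric]
      by (auto intro!: sum.cong simp: segment_point_def index_pairs_def algebra_simps)
    moreover have "(\<Sum>i\<in>UNIV. A k $ i $ i * segment_point t v w (Lam2 i i k) + b k $ i * segment_point t v w (Lam1 i k))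
      = (1 - t) * (\<Sum>i\<in>UNIV. A k $ i $ i * v (Lam2 i i k) + b k $ i * v (Lam1 i k))
        + t * (\<Sum>i\<in>UNIV. A k $ i $ i * w (Lam2 i i k) + b k $ i * w (Lam1 i k))"
      unfolding sum_distrib_left sum.distrib[symmetric]
      by (auto intro!: sum.cong simp: segment_point_def algebra_simps)
    ultimately show ?thesis
      unfolding R_def by (simp add: segment_point_def algebra_simps)
  qed
  show ?thesis
    unfolding sdp_objective_def R_def[symmetric] by (simp add: R sum.distrib sum_distrib_left)
qed

text \<open>
  Points on the segment from \<open>v\<close> to the uniform point, except \<open>v\<close> itself, have positive masses,
  and positive first moments in every coordinate of positive mean.  In a coordinate of mean 0 the
  hypothesis on \<open>S\<close> makes the total second moment 0, so every piece has second moment 0 there, as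
  required.  The objective is affine along the segment, so the bound passes to the limit \<open>v\<close>.
\<close>
lemma sdp_objective_le_rho_star:
  fixes \<mu> :: "'n::{finite,linorder} rvec" and A :: "'k::finite \<Rightarrow> 'n rmat"
  assumes n2: "CARD('n) \<ge> 2" and \<mu>: "\<mu> \<in> orthant" and S: "symmetric_matrix S"
    and diag: "\<And>i. 0 \<le> S $ i $ i" and zero: "\<And>i. \<mu> $ i = 0 \<Longrightarrow> S $ i $ i = 0"
    and A: "\<And>k. symmetric_matrix (A k)" and nonneg: "\<And>k i j. i \<noteq> j \<Longrightarrow> 0 \<le> A k $ i $ j"
    and v: "v \<in> sdp_feasible \<mu> S"
  shows "ereal (sdp_objective A b c v) \<le> rho_star \<mu> S A b c"
proof -
  define v0 :: "('n, 'k) sdp_variable \<Rightarrow> real" where "v0 = uniform_point \<mu> S"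
  have v0: "v0 \<in> sdp_feasible \<mu> S" unfolding v0_def by (rule uniform_point_feasible[OF v diag \<mu>])
  have approx: "ereal ((1 - t) * sdp_objective A b c v + t * sdp_objective A b c v0) \<le> rho_star \<mu> S A b c"
    if t: "0 < t" "t \<le> 1" for t
  proof -
    let ?u = "segment_point t v v0"
    have u: "?u \<in> sdp_feasible \<mu> S" using t by (intro segment_point_feasible v v0) auto
    have pos: "0 < ?u (Lam0 k)" for k
      using t sdp_feasible_bounded(1)[OF n2 v, of k]
      by (simp add: segment_point_def v0_def uniform_point_def add_nonneg_pos)
    have degenerate: "?u (Lam2 i i k) = 0" if "?u (Lam1 i k) = 0" for i k
    proof -
      have eq: "?u (Lam1 i k) = (1 - t) * v (Lam1 i k) + t * (\<mu> $ i / CARD('k))"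
        by (simp add: segment_point_def v0_def uniform_point_def)
      have "0 \<le> (1 - t) * v (Lam1 i k)" "0 \<le> t * (\<mu> $ i / CARD('k))"
        using t \<mu> sdp_feasible_bounded(3)[OF n2 v, of i k] by (auto simp: orthant_def)
      then have "t * (\<mu> $ i / CARD('k)) = 0" using eq that by linarith
      then have "\<mu> $ i = 0" using t by simp
      then show ?thesis
        using sdp_feasible_bounded(5,6)[OF n2 u, of i k] zero[of i] by simp
    qed
    have "\<exists>P\<in>Qcm \<mu> S. sdp_objective A b c ?u \<le> (\<integral>x. max_quadratic A b c x \<partial>P)"
      by (rule interior_feasible_dominated[OF n2 S _ _ u]) (fact A nonneg pos degenerate)+
    then obtain P where "P \<in> Qcm \<mu> S"
      "sdp_objective A b c ?u \<le> (\<integral>x. max_quadratic A b c x \<partial>P)" by blast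
    then have "ereal (sdp_objective A b c ?u) \<le> rho_star \<mu> S A b c"
      unfolding rho_star_def by (intro SUP_upper2[of P]) auto
    then show ?thesis by (simp add: sdp_objective_segment_point)
  qed
  have "(\<lambda>n. (1 - 1 / real (Suc n)) * sdp_objective A b c v + 1 / real (Suc n) * sdp_objective A b c v0)
      \<longlonglongrightarrow> (1 - 0) * sdp_objective A b c v + 0 * sdp_objective A b c v0"
    by (intro tendsto_intros LIMSEQ_Suc[OF lim_1_over_n])
  then have "(\<lambda>n. ereal ((1 - 1 / real (Suc n)) * sdp_objective A b c v + 1 / real (Suc n) * sdp_objective A b c v0))
      \<longlonglongrightarrow> ereal (sdp_objective A b c v)"
    by simp
  then show ?thesis
    by (rule LIMSEQ_le_const2) (intro exI allI impI approx; simp)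
qed

section \<open>Attainment\<close>

text \<open>
  In the product topology a box of intervals is compact by Tychonoff's theorem.  Names that are
  not variables get the singleton of the default value, which encodes extensionality, and
  the remaining constraints are closed conditions on finitely many coordinates.
\<close>
lemma compact_sdp_feasible:
  fixes \<mu> :: "'n::{finite,linorder} rvec"
  assumes n2: "CARD('n) \<ge> 2"
  shows "compact (sdp_feasible \<mu> S :: (('n, 'k::finite) sdp_variable \<Rightarrow> real) set)"
proof -
  let ?F = "sdp_feasible \<mu> S :: (('n, 'k) sdp_variable \<Rightarrow> real) set"
  let ?s = "\<lambda>i. \<bar>(\<mu> $ i)\<^sup>2 + S $ i $ i\<bar>"
  define bd where "bd u = (case u of Lam0 k \<Rightarrow> 1 | Lam1 i k \<Rightarrow> \<mu> $ i | Lam2 i j k \<Rightarrow> ?s i + ?s j)"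
    for u :: "('n, 'k) sdp_variable"
  define Box where "Box = (\<Pi>\<^sub>E u\<in>UNIV. if u \<in> sdp_variables then {- bd u..bd u} else {undefined})"
  define C :: "(('n, 'k) sdp_variable \<Rightarrow> real) set" where "C = {v. (\<Sum>k\<in>UNIV. v (Lam0 k)) = 1
     \<and> (\<forall>i. (\<Sum>k\<in>UNIV. v (Lam1 i k)) = \<mu> $ i)
     \<and> (\<forall>i. (\<Sum>k\<in>UNIV. v (Lam2 i i k)) = (\<mu> $ i)\<^sup>2 + S $ i $ i)
     \<and> (\<forall>i j. i < j \<longrightarrow> \<mu> $ i * \<mu> $ j + S $ i $ j \<le> (\<Sum>k\<in>UNIV. v (Lam2 i j k)))
     \<and> (\<forall>i j k. i < j \<longrightarrow> moment_psd (v (Lam0 k)) (v (Lam1 i k)) (v (Lam1 j k))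
          (v (Lam2 i i k)) (v (Lam2 i j k)) (v (Lam2 j j k)))
     \<and> (\<forall>i k. 0 \<le> v (Lam1 i k))}"
  have "compactin (product_topology (\<lambda>u. euclidean) UNIV) Box"
    unfolding Box_def compactin_PiE by simp
  then have "compact Box" by (simp add: euclidean_product_topology)
  have coord: "continuous_on UNIV (\<lambda>v. v u)" for u :: "('n, 'k) sdp_variable"
    by simp
  have "closed C"
    unfolding C_def moment_psd_def
    by (intro closed_Collect_conj closed_Collect_all closed_Collect_imp closed_Collect_le
        closed_Collect_eq continuous_intros coord open_Collect_const)
  have "v \<in> Box" if "v \<in> ?F" for v
  proof -
    have "v u \<in> (if u \<in> sdp_variables then {- bd u..bd u} else {undefined})" for u
    proof (cases "u \<in> sdp_variables")
      case True
      have "\<bar>v u\<bar> \<le> bd u"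
      proof (cases u)
        case (Lam0 k)
        then show ?thesis using sdp_feasible_bounded(1,2)[OF n2 that, of k] by (simp add: bd_def)
      next
        case (Lam1 i k)
        then show ?thesis using sdp_feasible_bounded(3,4)[OF n2 that, of i k] by (simp add: bd_def)
      next
        case (Lam2 i j k)
        show ?thesis
        proof (cases "i = j")
          case True
          then show ?thesis using Lam2 sdp_feasible_bounded(5,6)[OF n2 that, of i k] by (simp add: bd_def)
        next
          case False
          then have "i < j" using Lam2 True by simp
          from sdp_feasible_bounded(7)[OF n2 that this, of k] show ?thesis
            using Lam2 by (simp add: bd_def) 
        qed
      qed
      then show ?thesis using True by auto
    next
      case False
      then show ?thesis using that by (simp add: sdp_feasible_iff extensional_def)
    qed
    then show ?thesis by (simp add: Box_def PiE_def)
  qed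
  moreover have "v \<in> ?F \<longleftrightarrow> v \<in> C" if "v \<in> Box" for v
  proof -
    have "v u = undefined" if "u \<notin> sdp_variables" for u
      using PiE_mem[OF \<open>v \<in> Box\<close>[unfolded Box_def], of u] that by simp
    then have "v \<in> extensional sdp_variables" by (simp add: extensional_def)
    then show ?thesis by (simp add: sdp_feasible_iff C_def)
  qed
  ultimately have "?F = Box \<inter> C" by blast
  then show ?thesis using compact_Int_closed[OF \<open>compact Box\<close> \<open>closed C\<close>] by simp
qed

lemma sdp_optimum_attained:
  fixes \<mu> :: "'n::{finite,linorder} rvec" and A :: "'k::finite \<Rightarrow> 'n rmat"
  assumes "CARD('n) \<ge> 2" and "sdp_feasible \<mu> S \<noteq> ({} :: (('n, 'k) sdp_variable \<Rightarrow> real) set)"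
  shows "\<exists>v \<in> sdp_feasible \<mu> S. ereal (sdp_objective A b c v) = sdp_value \<mu> S A b c"
proof -
  have "continuous_on (sdp_feasible \<mu> S) (sdp_objective A b c)"
  proof (rule continuous_on_subset[OF _ subset_UNIV])
    show "continuous_on UNIV (sdp_objective A b c)"
      unfolding sdp_objective_def[abs_def] split_def
      by (intro continuous_intros continuous_on_product_coordinates)
  qed
  from continuous_attains_sup[OF compact_sdp_feasible[OF assms(1)] assms(2) this]
  obtain v where v: "v \<in> sdp_feasible \<mu> S"
    "\<And>w. w \<in> sdp_feasible \<mu> S \<Longrightarrow> sdp_objective A b c w \<le> sdp_objective A b c v" by blast
  then have "sdp_value \<mu> S A b c = ereal (sdp_objective A b c v)"
    unfolding sdp_value_def by (intro antisym SUP_least SUP_upper) auto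
  with v show ?thesis by metis
qed

section \<open>Size of the program\<close>

lemma card_index_pairs: "card (index_pairs :: ('n::{finite,linorder} \<times> 'n) set) = CARD('n) choose 2"
proof -
  have "bij_betw (\<lambda>(i, j). {i, j}) (index_pairs :: ('n \<times> 'n) set) {B. B \<subseteq> UNIV \<and> card B = 2}"
    unfolding bij_betw_def
  proof
    show "inj_on (\<lambda>(i, j). {i, j}) (index_pairs :: ('n \<times> 'n) set)"
      by (auto simp: inj_on_def index_pairs_def doubleton_eq_iff)
    show "(\<lambda>(i, j). {i, j}) ` (index_pairs :: ('n \<times> 'n) set) = {B. B \<subseteq> UNIV \<and> card B = 2}"
    proof (intro set_eqI iffI)
      fix B :: "'n set" assume "B \<in> {B. B \<subseteq> UNIV \<and> card B = 2}"
      then obtain i j where "B = {i, j}" "i \<noteq> j" by (auto simp: card_2_iff)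
      then have "B = {min i j, max i j}" "min i j < max i j" by (auto simp: min_def max_def)
      then show "B \<in> (\<lambda>(i, j). {i, j}) ` index_pairs"
        by (auto simp: index_pairs_def image_iff)
    qed (auto simp: index_pairs_def card_2_iff)
  qed
  from bij_betw_same_card[OF this] show ?thesis by (simp only: n_subsets[OF finite])
qed

lemma card_sdp_variables:
  "card (sdp_variables :: ('n::{finite,linorder}, 'k::finite) sdp_variable set)
     = CARD('k) * (1 + 2 * CARD('n) + (CARD('n) choose 2))"
proof -
  let ?pairs = "index_pairs :: ('n \<times> 'n) set"
  let ?V0 = "range Lam0 :: ('n, 'k) sdp_variable set"
  let ?V1 = "range (\<lambda>(i, k). Lam1 i k) :: ('n, 'k) sdp_variable set"
  let ?V2 = "range (\<lambda>(i, k). Lam2 i i k) :: ('n, 'k) sdp_variable set"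
  let ?V3 = "(\<lambda>(e, k). Lam2 (fst e) (snd e) k) ` (?pairs \<times> UNIV) :: ('n, 'k) sdp_variable set"
  have "sdp_variables = ((?V0 \<union> ?V1) \<union> ?V2) \<union> ?V3"
    unfolding sdp_variables_def by (intro arg_cong2[of _ _ _ _ "(\<union>)"]) force+
  also have "card \<dots> = card ?V0 + card ?V1 + card ?V2 + card ?V3"
  proof -
    have "?V0 \<inter> ?V1 = {}" "(?V0 \<union> ?V1) \<inter> ?V2 = {}" "(?V0 \<union> ?V1 \<union> ?V2) \<inter> ?V3 = {}"
      by (auto simp: index_pairs_def)
    then show ?thesis by (simp only: card_Un_disjoint finite finite_Un finite_imageI simp_thms)
  qed
  also have "\<dots> = CARD('k) + CARD('n) * CARD('k) + CARD('n) * CARD('k)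
      + (CARD('n) choose 2) * CARD('k)"
    by (subst card_image, force simp: inj_on_def prod_eq_iff)+
      (simp add: card_cartesian_product card_index_pairs)
  finally show ?thesis by (simp add: algebra_simps)
qed

lemma card_sdp_constraints:
  "card (sdp_constraints :: ('n::{finite,linorder}, 'k::finite) sdp_constraint set)
     = 1 + 2 * CARD('n) + (CARD('n) choose 2) + CARD('k) * ((CARD('n) choose 2) + CARD('n))"
proof -
  let ?pairs = "index_pairs :: ('n \<times> 'n) set"
  let ?C0 = "{Total_mass} :: ('n, 'k) sdp_constraint set"
  let ?C1 = "range Mean :: ('n, 'k) sdp_constraint set"
  let ?C2 = "range Second_moment :: ('n, 'k) sdp_constraint set"
  let ?C3 = "(\<lambda>e. Cross_moment (fst e) (snd e)) ` ?pairs :: ('n, 'k) sdp_constraint set"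
  let ?C4 = "(\<lambda>(e, k). Lmi (fst e) (snd e) k) ` (?pairs \<times> UNIV) :: ('n, 'k) sdp_constraint set"
  let ?C5 = "range (\<lambda>(i, k). Nonneg i k) :: ('n, 'k) sdp_constraint set"
  have "sdp_constraints = ((((?C0 \<union> ?C1) \<union> ?C2) \<union> ?C3) \<union> ?C4) \<union> ?C5"
    unfolding sdp_constraints_def by (intro arg_cong2[of _ _ _ _ "(\<union>)"]) force+
  also have "card \<dots> = card ?C0 + card ?C1 + card ?C2 + card ?C3 + card ?C4 + card ?C5"
  proof -
    have "?C0 \<inter> ?C1 = {}" "(?C0 \<union> ?C1) \<inter> ?C2 = {}" "(?C0 \<union> ?C1 \<union> ?C2) \<inter> ?C3 = {}"
      "(?C0 \<union> ?C1 \<union> ?C2 \<union> ?C3) \<inter> ?C4 = {}" "(?C0 \<union> ?C1 \<union> ?C2 \<union> ?C3 \<union> ?C4) \<inter> ?C5 = {}"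
      by auto
    then show ?thesis by (simp only: card_Un_disjoint finite finite_Un finite_imageI finite.intros simp_thms)
  qed
  also have "\<dots> = 1 + CARD('n) + CARD('n) + (CARD('n) choose 2)
      + (CARD('n) choose 2) * CARD('k) + CARD('n) * CARD('k)"
    by (subst card_image, force simp: inj_on_def prod_eq_iff)+
      (simp add: card_cartesian_product card_index_pairs)
  finally show ?thesis by (simp add: algebra_simps)
qed

section \<open>The value of the worst-case expectation\<close>

theorem theorem5p2:
  fixes \<mu> :: "'n::{finite,linorder} rvec"
    and S :: "'n rmat"
    and A :: "'k::finite \<Rightarrow> 'n rmat"
    and b :: "'k \<Rightarrow> 'n rvec"
    and c :: "'k \<Rightarrow> real"
  assumes "CARD('n) \<ge> 2"
    and "\<mu> \<in> orthant"
    and "symmetric_matrix S"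
    and "\<And>i. S $ i $ i \<ge> 0"
    and "\<And>i. \<mu> $ i = 0 \<Longrightarrow> S $ i $ i = 0"
    and "\<And>k. symmetric_matrix (A k)"
    and "\<And>k i j. i \<noteq> j \<Longrightarrow> A k $ i $ j \<ge> 0"
  shows "rho_star \<mu> S A b c = sdp_value \<mu> S A b c
    \<and> (sdp_feasible \<mu> S \<noteq> ({} :: (('n, 'k) sdp_variable \<Rightarrow> real) set) \<longrightarrow>
         (\<exists>v \<in> sdp_feasible \<mu> S. ereal (sdp_objective A b c v) = sdp_value \<mu> S A b c))
    \<and> card (sdp_variables :: ('n, 'k) sdp_variable set)
        = CARD('k) * (1 + 2 * CARD('n) + (CARD('n) choose 2))
    \<and> card (sdp_constraints :: ('n, 'k) sdp_constraint set)
        = 1 + 2 * CARD('n) + (CARD('n) choose 2) + CARD('k) * ((CARD('n) choose 2) + CARD('n))"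
proof (intro conjI impI)
  show "rho_star \<mu> S A b c = sdp_value \<mu> S A b c"
  proof (rule antisym)
    show "rho_star \<mu> S A b c \<le> sdp_value \<mu> S A b c"
      unfolding rho_star_def
    proof (rule SUP_least)
      fix P assume "P \<in> Qcm \<mu> S"
      from distribution_yields_feasible[where A=A and b=b and c=c, OF this assms(6)]
      obtain v where "v \<in> sdp_feasible \<mu> S" "sdp_objective A b c v = (\<integral>x. max_quadratic A b c x \<partial>P)"
        by blast
      then show "ereal (\<integral>x. max_quadratic A b c x \<partial>P) \<le> sdp_value \<mu> S A b c"
        unfolding sdp_value_def by (intro SUP_upper2[of v]) auto
    qed
    show "sdp_value \<mu> S A b c \<le> rho_star \<mu> S A b c"
      unfolding sdp_value_def by (intro SUP_least sdp_objective_le_rho_star assms)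
  qed
qed (use assms(1) in \<open>auto simp: sdp_optimum_attained card_sdp_variables card_sdp_constraints\<close>)

end
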